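(* Let $(X,d_X)$ be a proper, non-compact $\mathrm{CAT}(-1)$ space and let $\Gamma$ be a discrete and cocompact subgroup of the isometries of $X$. Let $G$ be the set of parametrized geodesics of $X$ with the topology of uniform convergence on compact sets, and let $\Omega\subset\partial_\infty^{\max}(X\times X)$ be the set of all classes (modulo additive constants) of functions $(z,z')\mapsto\max\{\beta^{p}_{\xi}(z),\beta^{p'}_{\xi'}(z')\}$ with $p,p'\in X$, $\xi,\xi'\in\partial_\infty X$, $\xi\neq\xi'$. Then the map $$f: G\longrightarrow\Omega,\qquad g\mapsto\lim_{n\to\infty}(g(n),g(-n)),$$ where the limit is taken in the compactification $\overline{X\times X}^{\max}$, is a $\Gamma$-equivariant homeomorphism.
   Context: A parametrized geodesic is an isometric embedding $g:\mathbb{R}\to X$; $\Gamma$ acts on $G$ by sending $g$ to $\gamma g$, i.e. $(\gamma g)(t)=\gamma(g(t))$. $\partial_\infty X$ is the ideal boundary of $X$ (equivalence classes of geodesic rays at bounded distance). For $\xi\in\partial_\infty X$ and $p\in X$, the Busemann function is $\beta_\xi^p(\cdot)=\lim_{t\to\infty}\bigl(d_X(\cdot,c(t))-t\bigr)$, where $c$ is the ray with $c(0)=p$, $c(\infty)=\xi$. On $X\times X$ consider the maximum metric $d_{\max}((x,y),(x',y'))=\max\{d_X(x,x'),d_X(y,y')\}$. Let $C_*$ be the space of continuous functions $X\times X\to\mathbb{R}$ (with the topology of uniform convergence on compact sets) modulo additive constants, and embed $X\times X$ in $C_*$ by $\iota(x,y)=[d_{\max}((x,y),\cdot)]$. The compactification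 $\overline{X\times X}^{\max}$ is the closure of $\iota(X\times X)$ in $C_*$, and $\partial_\infty^{\max}(X\times X)=\overline{X\times X}^{\max}\setminus\iota(X\times X)$. $\Omega$ has the subspace topology. The diagonal action of $\Gamma$ on $X\times X$, $\gamma(x,y)=(\gamma x,\gamma y)$, extends to an action by homeomorphisms on $\overline{X\times X}^{\max}$, namely $\gamma[h]=[h\circ\gamma^{-1}]$. "$\Gamma$ discrete and cocompact" means that $\Gamma$ acts properly discontinuously and cocompactly on $X$. *)

theory Defs
  imports "HOL-Analysis.Analysis" "HOL-Algebra.Group"
begin

section \<open>CAT(-1) spaces\<close>

text \<open>The hyperbolic plane of curvature \<open>-1\<close> in the hyperboloid model: the upper sheet of
  \<open>\<langle>u|u\<rangle> = -1\<close> for the form \<open>\<langle>u|v\<rangle> = - u0 v0 + u1 v1 + u2 v2\<close>, with the distance given by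
  \<open>cosh d = - \<langle>u|v\<rangle>\<close>.\<close>

definition neg_lorentz :: "real \<times> real \<times> real \<Rightarrow> real \<times> real \<times> real \<Rightarrow> real" where
  "neg_lorentz = (\<lambda>(u0, u1, u2) (v0, v1, v2). u0 * v0 - u1 * v1 - u2 * v2)"

definition hyp_plane :: "(real \<times> real \<times> real) set" where
  "hyp_plane = {u. neg_lorentz u u = 1 \<and> fst u > 0}"

definition hyp_dist :: "real \<times> real \<times> real \<Rightarrow> real \<times> real \<times> real \<Rightarrow> real" where
  "hyp_dist u v = arcosh (neg_lorentz u v)"

lemma neg_lorentz_ge_1:
  assumes "u \<in> hyp_plane" "v \<in> hyp_plane"
  shows "neg_lorentz u v \<ge> 1" and "neg_lorentz u v = 1 \<Longrightarrow> u = v"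
proof -
  obtain a b c where u: "u = (a, b, c)" by (cases u)
  obtain a' b' c' where v: "v = (a', b', c')" by (cases v)
  have 1: "a * a = 1 + b * b + c * c" "a > 0" "a' * a' = 1 + b' * b' + c' * c'" "a' > 0"
    using assms by (auto simp: u v hyp_plane_def neg_lorentz_def)
  define s where "s = 1 + b * b' + c * c'"
  have "(a * a') ^ 2 = (a * a) * (a' * a')" by (simp add: power2_eq_square mult_ac)
  then have eq: "(a * a') ^ 2 - s ^ 2 = (b - b') ^ 2 + (c - c') ^ 2 + (b * c' - c * b') ^ 2"
    unfolding 1 s_def by (simp add: power2_eq_square algebra_simps)
  have pos: "a * a' > 0" using 1 by simp
  have "s ^ 2 \<le> (a * a') ^ 2" using eq by (smt (verit) zero_le_power2)
  then have "s \<le> a * a'" using pos by (simp add: abs_le_square_iff[symmetric])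
  then show "neg_lorentz u v \<ge> 1" by (simp add: u v neg_lorentz_def s_def)
  assume "neg_lorentz u v = 1"
  then have "s = a * a'" by (simp add: u v neg_lorentz_def s_def)
  with eq have *: "(b - b') ^ 2 = 0" "(c - c') ^ 2 = 0" by (smt (verit) zero_le_power2)+
  then have "b = b'" "c = c'" by auto
  moreover from this 1 have "a ^ 2 = a' ^ 2" by (simp add: power2_eq_square)
  ultimately show "u = v" using 1 by (simp add: u v power2_eq_iff)
qed

lemma hyp_dist_commute: "hyp_dist u v = hyp_dist v u"
  unfolding hyp_dist_def neg_lorentz_def by (cases u; cases v) (simp add: mult.commute)

lemma hyp_dist_nonneg: "u \<in> hyp_plane \<Longrightarrow> v \<in> hyp_plane \<Longrightarrow> hyp_dist u v \<ge> 0"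
  by (simp add: hyp_dist_def neg_lorentz_ge_1)

lemma hyp_dist_eq_0_iff:
  assumes "u \<in> hyp_plane" "v \<in> hyp_plane"
  shows "hyp_dist u v = 0 \<longleftrightarrow> u = v"
proof -
  have "hyp_dist u v = 0 \<longleftrightarrow> neg_lorentz u v = 1"
    using neg_lorentz_ge_1(1)[OF assms] by (simp add: hyp_dist_def)
  also have "\<dots> \<longleftrightarrow> u = v"
    using neg_lorentz_ge_1(2)[OF assms] assms by (auto simp: hyp_plane_def)
  finally show ?thesis .
qed

lemma hyp_dist_triangle:
  assumes "u \<in> hyp_plane" "v \<in> hyp_plane" "w \<in> hyp_plane"
  shows "hyp_dist u w \<le> hyp_dist u v + hyp_dist v w"
proof -
  define A B C where "A = neg_lorentz u v" and "B = neg_lorentz v w" and "C = neg_lorentz u w"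
  have ge: "A \<ge> 1" "B \<ge> 1" "C \<ge> 1"
    using assms neg_lorentz_ge_1(1) by (auto simp: A_def B_def C_def)
  obtain a b c where u: "u = (a, b, c)" by (cases u)
  obtain d e f where v: "v = (d, e, f)" by (cases v)
  obtain g h i where w: "w = (g, h, i)" by (cases w)
  define P Q R where "P = neg_lorentz u u" and "Q = neg_lorentz v v" and "R = neg_lorentz w w"
  have 1: "P = 1" "Q = 1" "R = 1"
    using assms by (auto simp: P_def Q_def R_def hyp_plane_def)
  text \<open>The Gram determinant of three vectors in signature (2, 1).\<close>
  have "P * Q * R + 2 * A * B * C - Q * C\<^sup>2 - P * B\<^sup>2 - R * A\<^sup>2
      = (a * (e * i - f * h) - b * (d * i - f * g) + c * (d * h - e * g))\<^sup>2"
    unfolding P_def Q_def R_def A_def B_def C_def neg_lorentz_def u v w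
    by (simp add: power2_eq_square algebra_simps)
  then have "1 + 2 * A * B * C - C\<^sup>2 - B\<^sup>2 - A\<^sup>2 \<ge> 0" by (simp add: 1)
  then have "(C - A * B)\<^sup>2 \<le> (A\<^sup>2 - 1) * (B\<^sup>2 - 1)" by (simp add: power2_eq_square algebra_simps)
  then have "C - A * B \<le> sqrt ((A\<^sup>2 - 1) * (B\<^sup>2 - 1))" by (rule real_le_rsqrt)
  then have "C \<le> cosh (arcosh A + arcosh B)"
    using ge by (simp add: cosh_add sinh_arcosh_real real_sqrt_mult)
  then have "arcosh C \<le> arcosh (cosh (arcosh A + arcosh B))"
    using ge by (metis arcosh_real_strict_mono cosh_real_ge_1 less_eq_real_def)
  then show ?thesis
    using ge by (simp add: hyp_dist_def A_def B_def C_def arcosh_cosh_real)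
qed

text \<open>\<open>c\<close> is a geodesic path from \<open>x\<close> to \<open>y\<close>, parametrized by \<open>[0, d x y]\<close>, in the set \<open>M\<close>
  with the distance function \<open>d\<close>.\<close>

definition geodesic_path :: "'b set \<Rightarrow> ('b \<Rightarrow> 'b \<Rightarrow> real) \<Rightarrow> (real \<Rightarrow> 'b) \<Rightarrow> 'b \<Rightarrow> 'b \<Rightarrow> bool" where
  "geodesic_path M d c x y \<longleftrightarrow>
     c ` {0..d x y} \<subseteq> M \<and> c 0 = x \<and> c (d x y) = y \<and>
     (\<forall>s\<in>{0..d x y}. \<forall>t\<in>{0..d x y}. d (c s) (c t) = \<bar>s - t\<bar>)"

text \<open>Every geodesic triangle is at least as thin as its comparison triangle in the hyperbolic
  plane. Since all labellings \<open>x, y, z\<close> of the vertices are considered, it is enough to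
  compare points on the two sides issuing from \<open>x\<close>; the points \<open>c s\<close> and \<open>c1 s\<close> (likewise
  \<open>c' t\<close> and \<open>c1' t\<close>) correspond to each other because the paths have unit speed.\<close>

definition CAT_minus_one :: "'a::metric_space itself \<Rightarrow> bool" where
  "CAT_minus_one _ \<longleftrightarrow>
     (\<forall>x y :: 'a. \<exists>c. geodesic_path UNIV dist c x y) \<and>
     (\<forall>(x::'a) y z c c' x1 y1 z1 c1 c1'.
        geodesic_path UNIV dist c x y \<and> geodesic_path UNIV dist c' x z \<and>
        x1 \<in> hyp_plane \<and> y1 \<in> hyp_plane \<and> z1 \<in> hyp_plane \<and>
        hyp_dist x1 y1 = dist x y \<and> hyp_dist x1 z1 = dist x z \<and> hyp_dist y1 z1 = dist y z \<and>
        geodesic_path hyp_plane hyp_dist c1 x1 y1 \<and> geodesic_path hyp_plane hyp_dist c1' x1 z1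
        \<longrightarrow> (\<forall>s\<in>{0..dist x y}. \<forall>t\<in>{0..dist x z}. dist (c s) (c' t) \<le> hyp_dist (c1 s) (c1' t)))"


section \<open>Discrete cocompact groups of isometries\<close>

definition isometry_group :: "('a::metric_space \<Rightarrow> 'a) monoid" where
  "isometry_group =
     \<lparr>carrier = {\<gamma>. surj \<gamma> \<and> (\<forall>x y. dist (\<gamma> x) (\<gamma> y) = dist x y)},
      monoid.mult = (\<lambda>\<gamma> \<delta>. \<gamma> \<circ> \<delta>), one = id\<rparr>"

lemma isometry_bij: "\<gamma> \<in> carrier isometry_group \<Longrightarrow> bij \<gamma>"
  unfolding isometry_group_def bij_def inj_def by (auto, metis dist_eq_0_iff)

lemma group_isometry_group: "group (isometry_group :: ('a::metric_space \<Rightarrow> 'a) monoid)"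
proof (rule groupI)
  fix \<gamma> :: "'a \<Rightarrow> 'a" assume \<gamma>: "\<gamma> \<in> carrier isometry_group"
  then have "bij \<gamma>" by (rule isometry_bij)
  then have "inv_into UNIV \<gamma> \<in> carrier isometry_group"
    using \<gamma> by (simp add: isometry_group_def bij_is_inj inj_imp_surj_inv) (metis surj_f_inv_f)
  moreover have "inv_into UNIV \<gamma> \<circ> \<gamma> = id" using \<open>bij \<gamma>\<close> by (simp add: bij_is_inj)
  ultimately show "\<exists>\<delta>\<in>carrier isometry_group. \<delta> \<otimes>\<^bsub>isometry_group\<^esub> \<gamma> = \<one>\<^bsub>isometry_group\<^esub>"
    by (auto simp: isometry_group_def)
qed (simp_all add: isometry_group_def comp_assoc comp_surj[unfolded comp_def] comp_def)

definition properly_discontinuous :: "('a::topological_space \<Rightarrow> 'a) set \<Rightarrow> bool" where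
  "properly_discontinuous \<Gamma> \<longleftrightarrow> (\<forall>K. compact K \<longrightarrow> finite {\<gamma> \<in> \<Gamma>. \<gamma> ` K \<inter> K \<noteq> {}})"

definition cocompact :: "('a::topological_space \<Rightarrow> 'a) set \<Rightarrow> bool" where
  "cocompact \<Gamma> \<longleftrightarrow> (\<exists>K. compact K \<and> (\<Union>\<gamma>\<in>\<Gamma>. \<gamma> ` K) = UNIV)"


section \<open>Geodesics, ideal boundary and Busemann functions\<close>

definition geodesics :: "(real \<Rightarrow> 'a::metric_space) set" where
  "geodesics = {g. \<forall>s t. dist (g s) (g t) = \<bar>s - t\<bar>}"

text \<open>Rays are maps on \<open>[0, \<infinity>)\<close>; being \<open>extensional\<close> makes the ray with given origin and
  endpoint unique as a function on \<open>real\<close>.\<close>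

definition rays :: "(real \<Rightarrow> 'a::metric_space) set" where
  "rays = {c \<in> extensional {0..}. \<forall>s\<ge>0. \<forall>t\<ge>0. dist (c s) (c t) = \<bar>s - t\<bar>}"

definition asymptotic :: "((real \<Rightarrow> 'a::metric_space) \<times> (real \<Rightarrow> 'a)) set" where
  "asymptotic = {(c, c'). c \<in> rays \<and> c' \<in> rays \<and> (\<exists>B. \<forall>t\<ge>0. dist (c t) (c' t) \<le> B)}"

definition ideal_boundary :: "(real \<Rightarrow> 'a::metric_space) set set" where
  "ideal_boundary = rays // asymptotic"

definition ray_from :: "'a::metric_space \<Rightarrow> (real \<Rightarrow> 'a) set \<Rightarrow> real \<Rightarrow> 'a" where
  "ray_from p \<xi> = (THE c. c \<in> \<xi> \<and> c 0 = p)"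

definition busemann :: "'a::metric_space \<Rightarrow> (real \<Rightarrow> 'a) set \<Rightarrow> 'a \<Rightarrow> real" where
  "busemann p \<xi> z = Lim at_top (\<lambda>t. dist z (ray_from p \<xi> t) - t)"

lemma equiv_asymptotic: "equiv rays (asymptotic :: ((real \<Rightarrow> 'a::metric_space) \<times> _) set)"
proof (rule equivI)
  show "trans (asymptotic :: ((real \<Rightarrow> 'a) \<times> _) set)"
  proof (rule transI)
    fix a b c :: "real \<Rightarrow> 'a" assume "(a, b) \<in> asymptotic" "(b, c) \<in> asymptotic"
    then obtain B B' where B: "\<forall>t\<ge>0. dist (a t) (b t) \<le> B" "\<forall>t\<ge>0. dist (b t) (c t) \<le> B'"
      "a \<in> rays" "c \<in> rays"
      unfolding asymptotic_def by auto
    then have "\<forall>t\<ge>0. dist (a t) (c t) \<le> B + B'" by (meson add_mono dist_triangle order_trans)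
    with B show "(a, c) \<in> asymptotic" unfolding asymptotic_def by auto
  qed
  show "refl_on rays (asymptotic :: ((real \<Rightarrow> 'a) \<times> _) set)"
    by (rule refl_onI) (auto simp: asymptotic_def)
  show "sym (asymptotic :: ((real \<Rightarrow> 'a) \<times> _) set)"
    by (rule symI) (simp add: asymptotic_def, metis dist_commute)
qed (auto simp: asymptotic_def)


section \<open>Function spaces and the compactification\<close>

text \<open>The space of continuous functions with the topology of uniform convergence on compact
  sets.\<close>

definition compact_convergence ::
    "('b::topological_space \<Rightarrow> 'c::metric_space) topology" where
  "compact_convergence = topology (\<lambda>U. U \<subseteq> {h. continuous_on UNIV h} \<and>
     (\<forall>f\<in>U. \<exists>K \<epsilon>. compact K \<and> \<epsilon> > 0 \<and>
        {h. continuous_on UNIV h \<and> (\<forall>x\<in>K. dist (h x) (f x) < \<epsilon>)} \<subseteq> U))"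

lemma openin_compact_convergence:
  "openin compact_convergence U \<longleftrightarrow> U \<subseteq> {h. continuous_on UNIV h} \<and>
     (\<forall>f\<in>U. \<exists>K \<epsilon>. compact K \<and> \<epsilon> > 0 \<and>
        {h. continuous_on UNIV h \<and> (\<forall>x\<in>K. dist (h x) (f x) < \<epsilon>)} \<subseteq> U)"
  (is "_ = ?P U")
proof -
  have "istopology ?P"
    unfolding istopology_def
  proof (rule conjI; intro allI impI)
    fix S T assume ST: "?P S" "?P T"
    show "?P (S \<inter> T)"
    proof (intro conjI ballI)
      fix f assume f: "f \<in> S \<inter> T"
      with ST obtain K \<epsilon> where 1: "compact K" "\<epsilon> > 0"
        "{h. continuous_on UNIV h \<and> (\<forall>x\<in>K. dist (h x) (f x) < \<epsilon>)} \<subseteq> S" by (meson IntD1)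
      from f ST obtain K' \<epsilon>' where 2: "compact K'" "\<epsilon>' > 0"
        "{h. continuous_on UNIV h \<and> (\<forall>x\<in>K'. dist (h x) (f x) < \<epsilon>')} \<subseteq> T" by (meson IntD2)
      have "compact (K \<union> K')" "min \<epsilon> \<epsilon>' > 0" using 1 2 by auto
      moreover have "{h. continuous_on UNIV h \<and> (\<forall>x\<in>K \<union> K'. dist (h x) (f x) < min \<epsilon> \<epsilon>')} \<subseteq> S \<inter> T"
        using 1(3) 2(3) by auto
      ultimately show "\<exists>K \<epsilon>. compact K \<and> \<epsilon> > 0 \<and>
        {h. continuous_on UNIV h \<and> (\<forall>x\<in>K. dist (h x) (f x) < \<epsilon>)} \<subseteq> S \<inter> T" by blast
    qed (use ST in blast)
  next
    fix \<K> assume \<K>: "\<forall>S\<in>\<K>. ?P S"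
    show "?P (\<Union>\<K>)"
    proof (intro conjI ballI)
      fix f assume "f \<in> \<Union>\<K>"
      then obtain S where S: "S \<in> \<K>" "f \<in> S" by blast
      with \<K> obtain K \<epsilon> where "compact K" "\<epsilon> > 0"
        "{h. continuous_on UNIV h \<and> (\<forall>x\<in>K. dist (h x) (f x) < \<epsilon>)} \<subseteq> S" by meson
      with S show "\<exists>K \<epsilon>. compact K \<and> \<epsilon> > 0 \<and>
        {h. continuous_on UNIV h \<and> (\<forall>x\<in>K. dist (h x) (f x) < \<epsilon>)} \<subseteq> \<Union>\<K>" by blast
    qed (use \<K> in blast)
  qed
  then show ?thesis unfolding compact_convergence_def by simp
qed

lemma topspace_compact_convergence [simp]:
  "topspace compact_convergence = {h. continuous_on UNIV h}"
proof (rule equalityI)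
  show "topspace compact_convergence \<subseteq> {h. continuous_on UNIV h}"
    using openin_compact_convergence openin_topspace by blast
  have "openin compact_convergence {h. continuous_on UNIV h}"
    unfolding openin_compact_convergence by (auto intro!: exI[of _ "{}"] exI[of _ "1::real"])
  then show "{h. continuous_on UNIV h} \<subseteq> topspace compact_convergence"
    by (rule openin_subset)
qed

definition quotient_topology :: "'b topology \<Rightarrow> ('b \<Rightarrow> 'c) \<Rightarrow> 'c topology" where
  "quotient_topology T q =
     topology (\<lambda>U. U \<subseteq> q ` topspace T \<and> openin T {x \<in> topspace T. q x \<in> U})"

lemma openin_quotient_topology:
  "openin (quotient_topology T q) U \<longleftrightarrow> U \<subseteq> q ` topspace T \<and> openin T {x \<in> topspace T. q x \<in> U}"
proof -
  have "istopology (\<lambda>U. U \<subseteq> q ` topspace T \<and> openin T {x \<in> topspace T. q x \<in> U})"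
    unfolding istopology_def
  proof (intro conjI allI impI)
    fix S S' assume "S \<subseteq> q ` topspace T \<and> openin T {x \<in> topspace T. q x \<in> S}"
      "S' \<subseteq> q ` topspace T \<and> openin T {x \<in> topspace T. q x \<in> S'}"
    moreover have "{x \<in> topspace T. q x \<in> S \<inter> S'} =
      {x \<in> topspace T. q x \<in> S} \<inter> {x \<in> topspace T. q x \<in> S'}" by blast
    ultimately show "S \<inter> S' \<subseteq> q ` topspace T" "openin T {x \<in> topspace T. q x \<in> S \<inter> S'}" by auto
  next
    fix \<K> assume \<K>: "\<forall>K\<in>\<K>. K \<subseteq> q ` topspace T \<and> openin T {x \<in> topspace T. q x \<in> K}"
    have "{x \<in> topspace T. q x \<in> \<Union>\<K>} = (\<Union>K\<in>\<K>. {x \<in> topspace T. q x \<in> K})" by blast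
    with \<K> show "\<Union>\<K> \<subseteq> q ` topspace T" "openin T {x \<in> topspace T. q x \<in> \<Union>\<K>}" by auto
  qed
  then show ?thesis unfolding quotient_topology_def by simp
qed

lemma topspace_quotient_topology [simp]: "topspace (quotient_topology T q) = q ` topspace T"
proof (rule equalityI)
  show "topspace (quotient_topology T q) \<subseteq> q ` topspace T"
    using openin_topspace[of "quotient_topology T q"] unfolding openin_quotient_topology by (rule conjunct1)
  have "{x \<in> topspace T. q x \<in> q ` topspace T} = topspace T" by blast
  then have "openin (quotient_topology T q) (q ` topspace T)"
    unfolding openin_quotient_topology by simp
  then show "q ` topspace T \<subseteq> topspace (quotient_topology T q)" by (rule openin_subset)
qed

lemma quotient_map_quotient_topology: "quotient_map T (quotient_topology T q) q"
  unfolding quotient_map_def by (simp add: openin_quotient_topology)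

definition mod_constants :: "('b::topological_space \<Rightarrow> real) \<Rightarrow> ('b \<Rightarrow> real) set" where
  "mod_constants h = {k. \<exists>a. \<forall>w. k w = h w + a}"

lemma mod_constants_eq_iff:
  "mod_constants h = mod_constants k \<longleftrightarrow> (\<exists>a. \<forall>w. k w = h w + a)"
proof
  have "k \<in> mod_constants k" unfolding mod_constants_def by (auto intro: exI[of _ 0])
  then show "mod_constants h = mod_constants k \<Longrightarrow> \<exists>a. \<forall>w. k w = h w + a"
    unfolding mod_constants_def by blast
  assume "\<exists>a. \<forall>w. k w = h w + a"
  then obtain a where "\<forall>w. k w = h w + a" by blast
  then have k: "k = (\<lambda>w. h w + a)" by blast
  have "(\<exists>b. \<forall>w. f w = h w + b) \<longleftrightarrow> (\<exists>b. \<forall>w. f w = k w + b)" for f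
  proof
    assume "\<exists>b. \<forall>w. f w = h w + b"
    then obtain b where "\<forall>w. f w = h w + b" by blast
    then have "\<forall>w. f w = k w + (b - a)" by (simp add: k)
    then show "\<exists>b. \<forall>w. f w = k w + b" by blast
  next
    assume "\<exists>b. \<forall>w. f w = k w + b"
    then obtain b where "\<forall>w. f w = k w + b" by blast
    then have "\<forall>w. f w = h w + (a + b)" by (simp add: k)
    then show "\<exists>b. \<forall>w. f w = h w + b" by blast
  qed
  then show "mod_constants h = mod_constants k" unfolding mod_constants_def by simp
qed

definition C_star :: "('b::topological_space \<Rightarrow> real) set topology" where
  "C_star = quotient_topology compact_convergence mod_constants"

text \<open>The library distance on pairs is the Euclidean product metric; it induces the same
  (product) topology as \<open>d_max\<close>.\<close>

definition d_max :: "'a::metric_space \<times> 'a \<Rightarrow> 'a \<times> 'a \<Rightarrow> real" where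
  "d_max v w = max (dist (fst v) (fst w)) (dist (snd v) (snd w))"

definition max_embedding :: "'a::metric_space \<times> 'a \<Rightarrow> ('a \<times> 'a \<Rightarrow> real) set" where
  "max_embedding v = mod_constants (d_max v)"

definition max_compactification :: "('a::metric_space \<times> 'a \<Rightarrow> real) set topology" where
  "max_compactification = subtopology C_star (C_star closure_of range max_embedding)"

definition max_boundary :: "('a::metric_space \<times> 'a \<Rightarrow> real) set set" where
  "max_boundary = topspace max_compactification - range max_embedding"

definition Omega :: "('a::metric_space \<times> 'a \<Rightarrow> real) set set" where
  "Omega = {mod_constants (\<lambda>(z, z'). max (busemann p \<xi> z) (busemann p' \<xi>' z')) | p p' \<xi> \<xi>'.
     \<xi> \<in> ideal_boundary \<and> \<xi>' \<in> ideal_boundary \<and> \<xi> \<noteq> \<xi>'}"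

definition endpoint_map :: "(real \<Rightarrow> 'a::metric_space) \<Rightarrow> ('a \<times> 'a \<Rightarrow> real) set" where
  "endpoint_map g = (THE l. limitin max_compactification
     (\<lambda>n. max_embedding (g (real n), g (- real n))) l sequentially)"

text \<open>The diagonal action \<open>\<gamma>[h] = [h \<circ> \<gamma>^{-1}]\<close>, applied to all representatives of a class.\<close>

definition diag_action :: "('a \<Rightarrow> 'a) \<Rightarrow> ('a \<times> 'a \<Rightarrow> real) set \<Rightarrow> ('a \<times> 'a \<Rightarrow> real) set" where
  "diag_action \<gamma> A = (\<lambda>h. h \<circ> map_prod (inv_into UNIV \<gamma>) (inv_into UNIV \<gamma>)) ` A"

lemma diag_action_mod_constants:
  "diag_action \<gamma> (mod_constants h) =
    mod_constants (h \<circ> map_prod (inv_into UNIV \<gamma>) (inv_into UNIV \<gamma>))"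
proof (intro equalityI subsetI)
  fix k assume "k \<in> mod_constants (h \<circ> map_prod (inv_into UNIV \<gamma>) (inv_into UNIV \<gamma>))"
  then obtain a where a: "\<And>w. k w = h (map_prod (inv_into UNIV \<gamma>) (inv_into UNIV \<gamma>) w) + a"
    unfolding mod_constants_def by auto
  have "k = (\<lambda>w. h w + a) \<circ> map_prod (inv_into UNIV \<gamma>) (inv_into UNIV \<gamma>)"
    by (auto simp: a)
  then show "k \<in> diag_action \<gamma> (mod_constants h)"
    unfolding diag_action_def mod_constants_def by blast
qed (auto simp: diag_action_def mod_constants_def)

end

theory Submission
  imports Defs "HOL-Real_Asymp.Real_Asymp"
begin

text \<open>For a geodesic line \<open>g\<close> let \<open>u\<close> and \<open>v\<close> be the Busemann functions of its two ends, both
  normalised at \<open>g 0\<close>. After subtracting the constant \<open>n\<close>, the distance \<open>d_max\<close> from \<open>(g n, g (- n))\<close>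
  converges to \<open>(z, z') \<mapsto> max (u z) (v z')\<close>, so the limit of the points \<open>(g n, g (- n))\<close> is the class
  of this function. Four observations about it prove the theorem.

  \<^item> It is invisible in \<open>d_max\<close> itself, since it takes the value \<open>- n\<close> at \<open>(g n, g (- n))\<close> and is
    therefore unbounded below; so it represents a boundary point.

  \<^item> Two distinct boundary points are the ends of a line (\<open>line_between_rays\<close>), and changing the base
    points \<open>p\<close> and \<open>p'\<close> changes the two Busemann functions by constants \<open>- a\<close> and \<open>- b\<close>. A shift of
    the parameter of the line adds \<open>s\<close> to \<open>u\<close> and \<open>- s\<close> to \<open>v\<close>, which makes both constants equal; this
    is surjectivity (\<open>Omega_obtain_line\<close>).

  \<^item> Letting \<open>z'\<close> run to the second end makes \<open>v z'\<close> arbitrarily negative, so that the maximum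
    determines \<open>u\<close>, and likewise \<open>v\<close>, up to one common constant. By the triangle inequality
    \<open>u + v \<ge> 0\<close>, and in negative curvature equality holds only on the line (\<open>near_line\<close>). Hence the
    common constant is \<open>0\<close>, and \<open>g t\<close> is recovered as the only point with \<open>u = - t\<close> and \<open>v = t\<close>.

  \<^item> All of this is quantitative: if the functions of two lines agree up to a constant and up to a small
    error on a large ball, then the lines are close on a long interval
    (\<open>lines_close_if_max_busemann_close\<close>). Conversely the Busemann functions on a ball depend only on
    finitely many points of the line, up to an error that is uniform in the line
    (\<open>ray_busemann_uniform\<close>). This gives continuity in both directions.

  The curvature enters through two inequalities for triangles. One says that a point is close to a
  side of a triangle if it almost realises equality in the triangle inequality (\<open>almost_between\<close>);
  it yields all limits of segments, that is, rays and lines with prescribed ends. The other says that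
  two sides stay exponentially close up to about the Gromov product of their endpoints
  (\<open>fellow_travel\<close>).\<close>

section \<open>Comparison inequalities\<close>

text \<open>Segments, rays and lines are the unit speed paths on compact intervals, on \<open>{0..}\<close> and on \<open>UNIV\<close>.
  Nothing is prescribed outside \<open>I\<close>, so a line is also a ray and a segment.\<close>

definition unit_speed_on :: "real set \<Rightarrow> (real \<Rightarrow> 'a::metric_space) \<Rightarrow> bool" where
  "unit_speed_on I c \<longleftrightarrow> (\<forall>s\<in>I. \<forall>t\<in>I. dist (c s) (c t) = \<bar>s - t\<bar>)"

lemma unit_speed_onD: "unit_speed_on I c \<Longrightarrow> s \<in> I \<Longrightarrow> t \<in> I \<Longrightarrow> dist (c s) (c t) = \<bar>s - t\<bar>"
  by (simp add: unit_speed_on_def)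

lemma unit_speed_on_subset: "unit_speed_on I c \<Longrightarrow> J \<subseteq> I \<Longrightarrow> unit_speed_on J c"
  by (auto simp: unit_speed_on_def)

lemma unit_speed_on_shift: "unit_speed_on I c \<Longrightarrow> (\<And>t. t \<in> J \<Longrightarrow> a + t \<in> I) \<Longrightarrow> unit_speed_on J (\<lambda>t. c (a + t))"
  by (simp add: unit_speed_on_def)

lemma unit_speed_on_reflect: "unit_speed_on I c \<Longrightarrow> (\<And>t. t \<in> J \<Longrightarrow> a - t \<in> I) \<Longrightarrow> unit_speed_on J (\<lambda>t. c (a - t))"
  by (auto simp: unit_speed_on_def)

lemma geodesic_path_iff:
  "geodesic_path UNIV dist c x y \<longleftrightarrow> c 0 = x \<and> c (dist x y) = y \<and> unit_speed_on {0..dist x y} c"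
  by (auto simp: geodesic_path_def unit_speed_on_def)

lemma unit_speed_length: "unit_speed_on {0..a} c \<Longrightarrow> 0 \<le> a \<Longrightarrow> dist (c 0) (c a) = a"
  using unit_speed_onD[of "{0..a}" c 0 a] by simp

text \<open>The quotient \<open>q\<close> is \<open>1 - cos \<theta>\<close> for the angle \<open>\<theta>\<close> between the sides of lengths \<open>a\<close> and \<open>b\<close> in the
  hyperbolic triangle whose third side has length \<open>d\<close>. The bounds on \<open>q\<close> say that the law of cosines
  can be solved for \<open>\<theta>\<close>.\<close>

lemma cosh_diff_quotient_bounds:
  fixes a b d :: real
  assumes "0 < a" "0 < b" "\<bar>a - b\<bar> \<le> d" "d \<le> a + b"
  defines "q \<equiv> (cosh d - cosh (a - b)) / (sinh a * sinh b)"
  shows "0 \<le> q" "q \<le> 2" "cosh d = cosh (a - b) + sinh a * sinh b * q"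
proof -
  have pos: "sinh a * sinh b > 0" using assms by simp
  have "cosh \<bar>a - b\<bar> \<le> cosh d" using assms by (subst cosh_real_nonneg_le_iff) auto
  then show "0 \<le> q" using pos unfolding q_def by (intro divide_nonneg_pos) auto
  have "cosh d \<le> cosh (a + b)" using assms by (subst cosh_real_nonneg_le_iff) auto
  then have "cosh d - cosh (a - b) \<le> 2 * (sinh a * sinh b)" by (simp add: cosh_add cosh_diff)
  then show "q \<le> 2" using pos unfolding q_def by (simp add: pos_divide_le_eq)
  show "cosh d = cosh (a - b) + sinh a * sinh b * q"
    using nonzero_mult_div_cancel_left[of "sinh a * sinh b" "cosh d - cosh (a - b)"] pos
    by (simp only: q_def times_divide_eq_right)
qed

text \<open>The unit speed geodesic of the hyperboloid that leaves the base point \<open>(1, 0, 0)\<close> in the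
  direction \<open>(k, l)\<close>.\<close>

definition hyp_ray :: "real \<Rightarrow> real \<Rightarrow> real \<Rightarrow> real \<times> real \<times> real" where
  "hyp_ray k l t = (cosh t, sinh t * k, sinh t * l)"

lemma hyp_ray_in_plane:
  assumes "k\<^sup>2 + l\<^sup>2 = 1"
  shows "hyp_ray k l t \<in> hyp_plane"
proof -
  have "(sinh t * k) * (sinh t * k) + (sinh t * l) * (sinh t * l) = (sinh t)\<^sup>2 * (k\<^sup>2 + l\<^sup>2)"
    by (simp add: power2_eq_square algebra_simps)
  then show ?thesis
    using assms hyperbolic_pythagoras[of t]
    by (simp add: hyp_plane_def hyp_ray_def neg_lorentz_def power2_eq_square)
qed

lemma hyp_dist_hyp_ray:
  "hyp_dist (hyp_ray 1 0 s) (hyp_ray k l t) = arcosh (cosh (s - t) + sinh s * sinh t * (1 - k))"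
  by (simp add: hyp_dist_def hyp_ray_def neg_lorentz_def cosh_diff algebra_simps)

lemma hyp_dist_same_hyp_ray:
  assumes "k\<^sup>2 + l\<^sup>2 = 1"
  shows "hyp_dist (hyp_ray k l s) (hyp_ray k l t) = \<bar>s - t\<bar>"
proof -
  have "neg_lorentz (hyp_ray k l s) (hyp_ray k l t) = cosh s * cosh t - sinh s * sinh t * (k\<^sup>2 + l\<^sup>2)"
    by (simp add: hyp_ray_def neg_lorentz_def power2_eq_square algebra_simps)
  also have "\<dots> = cosh \<bar>s - t\<bar>" using assms by (simp add: cosh_diff)
  finally show ?thesis unfolding hyp_dist_def by (simp only: arcosh_cosh_real abs_ge_zero)
qed

lemma geodesic_path_hyp_ray:
  assumes "k\<^sup>2 + l\<^sup>2 = 1" "0 \<le> a"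
  shows "geodesic_path hyp_plane hyp_dist (hyp_ray k l) (hyp_ray k l 0) (hyp_ray k l a)"
  using assms by (auto simp: geodesic_path_def hyp_dist_same_hyp_ray hyp_ray_in_plane)

lemma CAT_minus_oneD:
  assumes "CAT_minus_one TYPE('a::metric_space)"
    and "geodesic_path UNIV dist c x y" "geodesic_path UNIV dist c' (x::'a) z"
    and "x1 \<in> hyp_plane" "y1 \<in> hyp_plane" "z1 \<in> hyp_plane"
    and "hyp_dist x1 y1 = dist x y" "hyp_dist x1 z1 = dist x z" "hyp_dist y1 z1 = dist y z"
    and "geodesic_path hyp_plane hyp_dist c1 x1 y1" "geodesic_path hyp_plane hyp_dist c1' x1 z1"
    and "s \<in> {0..dist x y}" "t \<in> {0..dist x z}"
  shows "dist (c s) (c' t) \<le> hyp_dist (c1 s) (c1' t)"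
  using assms unfolding CAT_minus_one_def by blast

locale proper_CAT_minus_one =
  fixes X :: "'a::metric_space itself"
  assumes CAT: "CAT_minus_one TYPE('a)"
    and proper: "\<And>(x::'a) r. compact (cball x r)"
begin

lemma segment_exists:
  fixes x y :: 'a
  obtains c where "unit_speed_on {0..dist x y} c" "c 0 = x" "c (dist x y) = y"
  using CAT unfolding CAT_minus_one_def geodesic_path_iff by blast

text \<open>The comparison triangle is placed with the common origin of the two sides at the base point of the
  hyperboloid and one side in the direction \<open>(1, 0)\<close>. Its angle there comes from the hyperbolic law of
  cosines, and the same law gives the distance between the two comparison points.\<close>

lemma comparison:
  fixes c c' :: "real \<Rightarrow> 'a"
  assumes c: "unit_speed_on {0..a} c" and c': "unit_speed_on {0..b} c'" and 0: "c 0 = c' 0"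
    and pos: "0 < a" "0 < b" and s: "s \<in> {0..a}" and t: "t \<in> {0..b}"
  shows "cosh (dist (c s) (c' t)) \<le>
    cosh (s - t) + sinh s * sinh t * ((cosh (dist (c a) (c' b)) - cosh (a - b)) / (sinh a * sinh b))"
proof -
  define d where "d = dist (c a) (c' b)"
  define q where "q = (cosh d - cosh (a - b)) / (sinh a * sinh b)"
  have a: "dist (c 0) (c a) = a" and b: "dist (c 0) (c' b) = b"
    using unit_speed_length[OF c] unit_speed_length[OF c'] pos 0 by auto
  have d: "\<bar>a - b\<bar> \<le> d" "d \<le> a + b"
    using dist_triangle[of "c 0" "c a" "c' b"] dist_triangle[of "c 0" "c' b" "c a"]
      dist_triangle[of "c a" "c' b" "c 0"] a b
    unfolding d_def by (simp_all add: dist_commute abs_le_iff)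
  have q: "0 \<le> q" "q \<le> 2" "cosh d = cosh (a - b) + sinh a * sinh b * q"
    using cosh_diff_quotient_bounds[OF pos d] by (auto simp: q_def)
  \<comment> \<open>\<open>(k, l)\<close> is the direction of the second side: the cosine and sine of the comparison angle.\<close>
  define k where "k = 1 - q"
  define l where "l = sqrt (1 - k\<^sup>2)"
  have "k\<^sup>2 \<le> 1" using q by (auto simp: k_def abs_square_le_1)
  then have kl: "k\<^sup>2 + l\<^sup>2 = 1" by (simp add: l_def)
  have ca: "geodesic_path UNIV dist c (c 0) (c a)" and cb: "geodesic_path UNIV dist c' (c 0) (c' b)"
    using c c' 0 a b by (simp_all add: geodesic_path_iff)
  have 1: "(1::real)\<^sup>2 + 0\<^sup>2 = 1" by simp
  have H0: "hyp_ray k l 0 = hyp_ray 1 0 0" by (simp add: hyp_ray_def)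
  have h: "hyp_dist (hyp_ray 1 0 s) (hyp_ray k l t) = arcosh (cosh (s - t) + sinh s * sinh t * q)" for s t
    by (simp add: hyp_dist_hyp_ray k_def)
  have "0 \<le> d" by (simp add: d_def)
  have hd: "hyp_dist (hyp_ray 1 0 a) (hyp_ray k l b) = d"
    unfolding h q(3)[symmetric] using \<open>0 \<le> d\<close> by (rule arcosh_cosh_real)
  have "dist (c s) (c' t) \<le> hyp_dist (hyp_ray 1 0 s) (hyp_ray k l t)"
  proof (rule CAT_minus_oneD[OF CAT ca cb])
    show "hyp_ray 1 0 0 \<in> hyp_plane" "hyp_ray 1 0 a \<in> hyp_plane" "hyp_ray k l b \<in> hyp_plane"
      using hyp_ray_in_plane[OF 1] hyp_ray_in_plane[OF kl] by auto
    show "hyp_dist (hyp_ray 1 0 0) (hyp_ray 1 0 a) = dist (c 0) (c a)"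
      using hyp_dist_same_hyp_ray[OF 1] pos a by simp
    show "hyp_dist (hyp_ray 1 0 0) (hyp_ray k l b) = dist (c 0) (c' b)"
      using hyp_dist_same_hyp_ray[OF kl, of 0 b] pos b H0 by simp
    show "hyp_dist (hyp_ray 1 0 a) (hyp_ray k l b) = dist (c a) (c' b)"
      using hd by (simp add: d_def)
    show "geodesic_path hyp_plane hyp_dist (hyp_ray 1 0) (hyp_ray 1 0 0) (hyp_ray 1 0 a)"
      using geodesic_path_hyp_ray[OF 1] pos by simp
    show "geodesic_path hyp_plane hyp_dist (hyp_ray k l) (hyp_ray 1 0 0) (hyp_ray k l b)"
      using geodesic_path_hyp_ray[OF kl, of b] pos H0 by simp
  qed (use s t a b in auto)
  then have "cosh (dist (c s) (c' t)) \<le> cosh (arcosh (cosh (s - t) + sinh s * sinh t * q))"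
    unfolding h by (meson cosh_real_nonneg_le_iff order_trans zero_le_dist)
  moreover have "1 \<le> cosh (s - t) + sinh s * sinh t * q"
    using cosh_real_ge_1[of "s - t"] s t q by (simp add: add_increasing2)
  ultimately show ?thesis by (simp add: q_def d_def)
qed

text \<open>For a vertex and a point on the opposite side, the comparison distance is a combination of the
  other two sides with hyperbolic sines as weights: this is the hyperbolic form of Stewart's theorem.\<close>

lemma stewart:
  fixes c :: "real \<Rightarrow> 'a"
  assumes c: "unit_speed_on {0..l} c" and l: "0 < l" and s: "s \<in> {0..l}"
  shows "sinh l * cosh (dist z (c s)) \<le> sinh (l - s) * cosh (dist z (c 0)) + sinh s * cosh (dist z (c l))"
proof (cases "z = c 0")
  case True
  then show ?thesis
    using unit_speed_onD[OF c, of 0 s] unit_speed_onD[OF c, of 0 l] l s by (simp add: sinh_diff)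
next
  case False
  define b where "b = dist (c 0) z"
  obtain c' where c': "unit_speed_on {0..b} c'" "c' 0 = c 0" "c' b = z"
    using segment_exists[of "c 0" z] b_def by metis
  have b: "0 < b" using False by (simp add: b_def)
  define d where "d = dist z (c l)"
  have "cosh (dist z (c s)) \<le> cosh (s - b) + sinh s * sinh b * ((cosh d - cosh (l - b)) / (sinh l * sinh b))"
    using comparison[OF c c'(1) c'(2)[symmetric] l b s, of b] b c'(3) by (simp add: d_def dist_commute)
  also have "\<dots> = cosh (s - b) + sinh s * (cosh d - cosh (l - b)) / sinh l"
    using b by simp
  finally have "sinh l * cosh (dist z (c s)) \<le> sinh l * (cosh (s - b) + sinh s * (cosh d - cosh (l - b)) / sinh l)"
    using l by (intro mult_left_mono) auto
  also have "\<dots> = sinh l * cosh (s - b) + sinh s * (cosh d - cosh (l - b))"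
    using l by (simp add: distrib_left)
  also have "\<dots> = sinh (l - s) * cosh b + sinh s * cosh d"
    by (simp add: sinh_diff cosh_diff algebra_simps)
  finally show ?thesis by (simp add: b_def d_def dist_commute)
qed

end

lemma cosh_le_twice_sinh:
  fixes l :: real
  assumes "1 \<le> l"
  shows "cosh l \<le> 2 * sinh l"
proof -
  have "3 \<le> exp (2 * l)" using exp_ge_add_one_self[of "2 * l"] assms by linarith
  then have "3 * exp (- l) \<le> exp (2 * l) * exp (- l)" by (intro mult_right_mono) auto
  also have "\<dots> = exp l" by (simp add: exp_add[symmetric])
  finally show ?thesis by (simp add: sinh_field_def cosh_field_def field_simps)
qed

lemma cosh_plus_twice_sinh_le:
  fixes e :: real
  assumes "0 \<le> e"
  shows "cosh e + 2 * sinh e \<le> exp (2 * e)"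
proof -
  define x where "x = exp e"
  have x: "1 \<le> x" using assms by (simp add: x_def)
  have e: "exp (- e) = 1 / x" "exp (2 * e) = x ^ 2"
    by (simp_all add: x_def exp_minus inverse_eq_divide exp_double)
  have "0 \<le> (x - 1) ^ 2 * (2 * x + 1)" using x by simp
  also have "\<dots> = 2 * x ^ 3 - 3 * x ^ 2 + 1" by (simp add: power2_eq_square power3_eq_cube algebra_simps)
  finally have "3 * x ^ 2 - 1 \<le> 2 * x ^ 2 * x" by (simp add: power3_eq_cube power2_eq_square)
  then have "(3 * x ^ 2 - 1) / x \<le> 2 * x ^ 2" using x by (simp add: pos_divide_le_eq)
  moreover have "cosh e + 2 * sinh e = (3 * x ^ 2 - 1) / x / 2"
    using x by (simp add: sinh_field_def cosh_field_def e x_def[symmetric] field_simps power2_eq_square)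
  ultimately show ?thesis by (simp add: e)
qed

lemma sinh_quotient_le_exp:
  fixes t a :: real
  assumes "t \<le> a" "0 < a"
  shows "sinh t / sinh a \<le> exp (t - a)"
proof -
  have "exp (t - a) \<le> exp (a - t)" using assms by simp
  moreover have "exp (t - a) * sinh a = (exp t - exp (t - a - a)) / 2"
    by (simp add: sinh_field_def right_diff_distrib exp_add[symmetric] diff_divide_distrib)
  moreover have "exp (t - a - a) \<le> exp (- t)" using assms by simp
  ultimately have "sinh t \<le> exp (t - a) * sinh a" by (simp add: sinh_field_def)
  then show ?thesis using assms by (simp add: pos_divide_le_eq)
qed

lemma cosh_le_exp: "0 \<le> d \<Longrightarrow> cosh d \<le> exp (d::real)"
  by (simp add: cosh_field_def)

context proper_CAT_minus_one
begin

text \<open>In Stewart's inequality the distances \<open>s\<close> and \<open>l - s\<close> to the ends of the side give exactly \<open>cosh 0\<close>;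
  an excess \<open>\<eta>\<close> in both of them changes the result by an amount that depends on \<open>\<eta>\<close> alone, however
  long the side is. The bound on the length only serves to replace \<open>coth l\<close> by a constant.\<close>

lemma almost_between:
  fixes c :: "real \<Rightarrow> 'a"
  assumes c: "unit_speed_on {\<alpha>..\<beta>} c" and long: "1 \<le> \<beta> - \<alpha>" and t: "t \<in> {\<alpha>..\<beta>}" and \<eta>: "0 \<le> \<eta>"
    and z\<alpha>: "dist z (c \<alpha>) \<le> t - \<alpha> + \<eta>" and z\<beta>: "dist z (c \<beta>) \<le> \<beta> - t + \<eta>"
  shows "cosh (dist z (c t)) \<le> exp (2 * \<eta>)"
proof -
  define l s where "l = \<beta> - \<alpha>" and "s = t - \<alpha>"
  have l: "1 \<le> l" and s: "s \<in> {0..l}" using long t by (auto simp: l_def s_def)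
  have "unit_speed_on {0..l} (\<lambda>r. c (\<alpha> + r))"
    by (rule unit_speed_on_shift[OF c]) (auto simp: l_def)
  from stewart[OF this _ s, of z]
  have "sinh l * cosh (dist z (c t)) \<le> sinh (l - s) * cosh (dist z (c \<alpha>)) + sinh s * cosh (dist z (c \<beta>))"
    using l by (simp add: l_def s_def)
  also have "\<dots> \<le> sinh (l - s) * cosh (s + \<eta>) + sinh s * cosh (l - s + \<eta>)"
    using s \<eta> z\<alpha> z\<beta> by (intro add_mono mult_left_mono) (auto simp: cosh_real_nonneg_le_iff l_def s_def)
  also have "\<dots> = cosh \<eta> * sinh l + sinh \<eta> * (2 * sinh s * sinh (l - s))"
    using sinh_add[of s "l - s"] cosh_add[of "l - s" \<eta>] by (simp add: cosh_add algebra_simps)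
  also have "\<dots> \<le> cosh \<eta> * sinh l + sinh \<eta> * cosh l"
  proof -
    have "2 * sinh s * sinh (l - s) = cosh l - cosh (s - (l - s))"
      using cosh_add[of s "l - s"] cosh_diff[of s "l - s"] by simp
    then have "2 * sinh s * sinh (l - s) \<le> cosh l" by simp
    then show ?thesis using \<eta> by (intro add_left_mono mult_left_mono) auto
  qed
  also have "\<dots> \<le> cosh \<eta> * sinh l + sinh \<eta> * (2 * sinh l)"
    using \<eta> cosh_le_twice_sinh[OF l] by (intro add_left_mono mult_left_mono) auto
  also have "\<dots> = sinh l * (cosh \<eta> + 2 * sinh \<eta>)" by (simp add: algebra_simps)
  finally have "cosh (dist z (c t)) \<le> cosh \<eta> + 2 * sinh \<eta>" using l by simp
  also have "\<dots> \<le> exp (2 * \<eta>)" using \<eta> by (rule cosh_plus_twice_sinh_le)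
  finally show ?thesis .
qed

text \<open>The exponent is twice the difference of \<open>t\<close> and the Gromov product of \<open>c a\<close> and \<open>c' b\<close> at the common
  origin.\<close>

lemma fellow_travel:
  fixes c c' :: "real \<Rightarrow> 'a"
  assumes c: "unit_speed_on {0..a} c" and c': "unit_speed_on {0..b} c'" and 0: "c 0 = c' 0"
    and t: "0 \<le> t" "t \<le> a" "t \<le> b"
  shows "cosh (dist (c t) (c' t)) \<le> 1 + exp (2 * t - a - b + dist (c a) (c' b))"
proof (cases "t = 0")
  case True
  then show ?thesis using 0 by simp
next
  case False
  then have pos: "0 < a" "0 < b" using t by auto
  define d where "d = dist (c a) (c' b)"
  have "cosh (dist (c t) (c' t)) \<le> 1 + sinh t * sinh t * ((cosh d - cosh (a - b)) / (sinh a * sinh b))"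
    using comparison[OF c c' 0 pos, of t t] t by (simp add: d_def)
  also have "\<dots> = 1 + (sinh t / sinh a) * (sinh t / sinh b) * (cosh d - cosh (a - b))"
    by simp
  also have "\<dots> \<le> 1 + (sinh t / sinh a) * (sinh t / sinh b) * exp d"
  proof -
    have "cosh d - cosh (a - b) \<le> exp d"
      using cosh_le_exp[of d] cosh_real_nonneg[of "a - b"] by (simp add: d_def del: cosh_real_nonneg)
    then show ?thesis using t pos by (intro add_left_mono mult_left_mono) auto
  qed
  also have "\<dots> \<le> 1 + exp (t - a) * exp (t - b) * exp d"
    using t pos by (intro add_left_mono mult_right_mono mult_mono sinh_quotient_le_exp) auto
  also have "exp (t - a) * exp (t - b) * exp d = exp (2 * t - a - b + d)"
    by (simp add: exp_add[symmetric])
  finally show ?thesis by (simp add: d_def)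
qed

end

section \<open>Limits of segments, rays and Busemann functions\<close>

lemma dist_less_if_cosh_less: "cosh (dist x y) < cosh e \<Longrightarrow> 0 < e \<Longrightarrow> dist x y < e"
  by (simp add: cosh_real_nonneg_less_iff)

lemma tendsto_0_if_cosh_le:
  fixes d \<eta> :: "nat \<Rightarrow> real"
  assumes "\<And>n. 0 \<le> d n" "\<And>n. cosh (d n) \<le> exp (2 * \<eta> n)" "\<eta> \<longlonglongrightarrow> 0"
  shows "d \<longlonglongrightarrow> 0"
proof (rule order_tendstoI)
  fix e :: real assume e: "0 < e"
  have "(\<lambda>n. exp (2 * \<eta> n)) \<longlonglongrightarrow> exp (2 * 0)" using assms(3) by (intro tendsto_intros)
  moreover have "exp (2 * 0) < cosh e" using e cosh_real_nonneg_less_iff[of 0 e] by simp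
  ultimately have "\<forall>\<^sub>F n in sequentially. exp (2 * \<eta> n) < cosh e" by (rule order_tendstoD)
  then show "\<forall>\<^sub>F n in sequentially. d n < e"
  proof eventually_elim
    case (elim n)
    then have "cosh (d n) < cosh e" using assms(2)[of n] by linarith
    then show ?case using assms(1) e by (simp add: cosh_real_nonneg_less_iff)
  qed
qed (use assms(1) in \<open>auto intro: always_eventually less_le_trans\<close>)

context proper_CAT_minus_one
begin

lemma Cauchy_converges:
  fixes x :: "nat \<Rightarrow> 'a"
  assumes "Cauchy x"
  shows "\<exists>l. x \<longlonglongrightarrow> l"
proof -
  have "bounded (range x)" using assms by (rule cauchy_imp_bounded)
  then obtain a r where "range x \<subseteq> cball a r" by (auto simp: bounded_def subset_iff)
  moreover have "complete (cball a r)" using proper by (rule compact_imp_complete)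
  ultimately show ?thesis using assms unfolding complete_def by blast
qed

text \<open>If the \<open>n\<close>-th segment, prolonged at both sides to the ends of a later one, is almost geodesic, then each point of
  the \<open>n\<close>-th segment is almost between the ends of the later one, hence close to its point with the
  same parameter. So the segments form a Cauchy sequence at each parameter.\<close>

lemma segments_converge:
  fixes \<sigma> :: "nat \<Rightarrow> real \<Rightarrow> 'a"
  assumes \<sigma>: "\<And>n. unit_speed_on {\<alpha> n..\<beta> n} (\<sigma> n)"
    and left: "\<And>m n. n \<le> m \<Longrightarrow> dist (\<sigma> n (\<alpha> n)) (\<sigma> m (\<alpha> m)) \<le> \<alpha> n - \<alpha> m + \<eta> n"
    and right: "\<And>m n. n \<le> m \<Longrightarrow> dist (\<sigma> n (\<beta> n)) (\<sigma> m (\<beta> m)) \<le> \<beta> m - \<beta> n + \<eta> n"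
    and \<eta>: "\<And>n. 0 \<le> \<eta> n" "\<eta> \<longlonglongrightarrow> 0"
    and \<beta>: "filterlim \<beta> at_top sequentially"
    and \<alpha>: "decseq \<alpha>"
  obtains g where "unit_speed_on {t. \<exists>n. \<alpha> n \<le> t} g"
    and "\<And>n t. \<alpha> n \<le> t \<Longrightarrow> t \<le> \<beta> n \<Longrightarrow> cosh (dist (\<sigma> n t) (g t)) \<le> exp (2 * \<eta> n)"
proof -
  define I where "I = {t. \<exists>n. \<alpha> n \<le> t}"
  have long: "\<forall>\<^sub>F m in sequentially. 1 \<le> \<beta> m - \<alpha> m"
  proof -
    have "\<forall>\<^sub>F m in sequentially. \<alpha> 0 + 1 \<le> \<beta> m" using \<beta> by (simp add: filterlim_at_top)
    then show ?thesis
    proof eventually_elim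
      case (elim m)
      have "\<alpha> m \<le> \<alpha> 0" using \<alpha> by (simp add: decseq_def)
      with elim show ?case by linarith
    qed
  qed
  have inside: "\<forall>\<^sub>F m in sequentially. t \<in> {\<alpha> m..\<beta> m}" if "t \<in> I" for t
  proof -
    from that obtain n where n: "\<alpha> n \<le> t" by (auto simp: I_def)
    have "\<forall>\<^sub>F m in sequentially. t \<le> \<beta> m" using \<beta> by (simp add: filterlim_at_top)
    then show ?thesis using eventually_ge_at_top[of n]
    proof eventually_elim
      case (elim m)
      have "\<alpha> m \<le> \<alpha> n" using \<alpha> elim by (simp add: decseq_def)
      with elim n show ?case by simp
    qed
  qed
  have key: "cosh (dist (\<sigma> n t) (\<sigma> m t)) \<le> exp (2 * \<eta> n)"
    if "n \<le> m" "t \<in> {\<alpha> n..\<beta> n}" "t \<in> {\<alpha> m..\<beta> m}" "1 \<le> \<beta> m - \<alpha> m" for n m t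
  proof (rule almost_between[OF \<sigma> that(4,3) \<eta>(1)])
    have 1: "dist (\<sigma> n t) (\<sigma> n (\<alpha> n)) = t - \<alpha> n" "dist (\<sigma> n t) (\<sigma> n (\<beta> n)) = \<beta> n - t"
      using unit_speed_onD[OF \<sigma>] that(2) by auto
    show "dist (\<sigma> n t) (\<sigma> m (\<alpha> m)) \<le> t - \<alpha> m + \<eta> n"
      using dist_triangle[of "\<sigma> n t" "\<sigma> m (\<alpha> m)" "\<sigma> n (\<alpha> n)"] left[OF that(1)] 1 by linarith
    show "dist (\<sigma> n t) (\<sigma> m (\<beta> m)) \<le> \<beta> m - t + \<eta> n"
      using dist_triangle[of "\<sigma> n t" "\<sigma> m (\<beta> m)" "\<sigma> n (\<beta> n)"] right[OF that(1)] 1 by linarith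
  qed
  have "\<exists>l. (\<lambda>n. \<sigma> n t) \<longlonglongrightarrow> l" if t: "t \<in> I" for t
  proof (rule Cauchy_converges, unfold Cauchy_altdef, intro allI impI)
    fix e :: real assume e: "0 < e"
    have "(\<lambda>n. exp (2 * \<eta> n)) \<longlonglongrightarrow> exp (2 * 0)" using \<eta>(2) by (intro tendsto_intros)
    moreover have "exp (2 * 0) < cosh e" using e cosh_real_nonneg_less_iff[of 0 e] by simp
    ultimately have "\<forall>\<^sub>F n in sequentially. exp (2 * \<eta> n) < cosh e" by (rule order_tendstoD)
    with inside[OF t] long have "\<forall>\<^sub>F n in sequentially. exp (2 * \<eta> n) < cosh e \<and> t \<in> {\<alpha> n..\<beta> n} \<and> 1 \<le> \<beta> n - \<alpha> n"
      by eventually_elim auto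
    then obtain M where M: "\<And>n. M \<le> n \<Longrightarrow> exp (2 * \<eta> n) < cosh e \<and> t \<in> {\<alpha> n..\<beta> n} \<and> 1 \<le> \<beta> n - \<alpha> n"
      unfolding eventually_sequentially by blast
    have "dist (\<sigma> n t) (\<sigma> m t) < e" if "M \<le> n" "n < m" for n m
      using key[of n m t] M[of n] M[of m] that e
      by (intro dist_less_if_cosh_less) (auto simp del: atLeastAtMost_iff)
    then show "\<exists>M. \<forall>m\<ge>M. \<forall>n>m. dist (\<sigma> m t) (\<sigma> n t) < e" by blast
  qed
  then obtain g where g: "\<And>t. t \<in> I \<Longrightarrow> (\<lambda>n. \<sigma> n t) \<longlonglongrightarrow> g t" by metis
  show ?thesis
  proof (rule that)
    show "unit_speed_on {t. \<exists>n. \<alpha> n \<le> t} g"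
      unfolding unit_speed_on_def I_def[symmetric]
    proof (intro ballI)
      fix s t assume st: "s \<in> I" "t \<in> I"
      have "(\<lambda>n. dist (\<sigma> n s) (\<sigma> n t)) \<longlonglongrightarrow> dist (g s) (g t)" by (intro tendsto_intros g st)
      moreover have "(\<lambda>n. dist (\<sigma> n s) (\<sigma> n t)) \<longlonglongrightarrow> \<bar>s - t\<bar>"
        by (rule tendsto_eventually, use inside[OF st(1)] inside[OF st(2)] in eventually_elim)
          (rule unit_speed_onD[OF \<sigma>])
      ultimately show "dist (g s) (g t) = \<bar>s - t\<bar>" by (rule LIMSEQ_unique)
    qed
    fix n t assume nt: "\<alpha> n \<le> t" "t \<le> \<beta> n"
    then have t: "t \<in> I" by (auto simp: I_def)
    have "(\<lambda>m. cosh (dist (\<sigma> n t) (\<sigma> m t))) \<longlonglongrightarrow> cosh (dist (\<sigma> n t) (g t))"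
      by (intro tendsto_intros g t)
    moreover have "\<forall>\<^sub>F m in sequentially. cosh (dist (\<sigma> n t) (\<sigma> m t)) \<le> exp (2 * \<eta> n)"
      using inside[OF t] long eventually_ge_at_top[of n]
      by eventually_elim (use nt in \<open>auto intro!: key\<close>)
    ultimately show "cosh (dist (\<sigma> n t) (g t)) \<le> exp (2 * \<eta> n)"
      by (rule tendsto_upperbound) simp
  qed
qed

end

text \<open>In contrast to \<open>busemann\<close>, which selects a ray from a boundary class, this is defined for the path
  itself; it depends only on the values of the path at large parameters.\<close>

definition ray_busemann :: "(real \<Rightarrow> 'a::metric_space) \<Rightarrow> 'a \<Rightarrow> real" where
  "ray_busemann c z = Lim at_top (\<lambda>t. dist z (c t) - t)"

lemma ray_busemann_cong:
  assumes "\<And>t. 0 \<le> t \<Longrightarrow> c t = c' t"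
  shows "ray_busemann c z = ray_busemann c' z"
proof -
  have "\<forall>\<^sub>F t in at_top. dist z (c t) - t = dist z (c' t) - t"
    using eventually_ge_at_top[of "0::real"] by eventually_elim (simp add: assms)
  then have "((\<lambda>t. dist z (c t) - t) \<longlongrightarrow> l) at_top \<longleftrightarrow> ((\<lambda>t. dist z (c' t) - t) \<longlongrightarrow> l) at_top" for l
    by (rule tendsto_cong)
  then show ?thesis unfolding ray_busemann_def Topological_Spaces.Lim_def by simp
qed

context
  fixes c :: "real \<Rightarrow> 'a::metric_space"
  assumes c: "unit_speed_on {0..} c"
begin

lemma tendsto_ray_busemann: "((\<lambda>t. dist z (c t) - t) \<longlongrightarrow> ray_busemann c z) at_top"
proof -
  define f where "f t = dist z (c t) - t" for t
  have dec: "f t \<le> f s" if "0 \<le> s" "s \<le> t" for s t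
    using dist_triangle[of z "c t" "c s"] unit_speed_onD[OF c, of s t] that by (simp add: f_def)
  have low: "- dist z (c 0) \<le> f t" if "0 \<le> t" for t
    using dist_triangle[of "c 0" "c t" z] unit_speed_onD[OF c, of 0 t] that
    by (simp add: f_def dist_commute)
  define L where "L = Inf (f ` {0..})"
  have bdd: "bdd_below (f ` {0..})" using low by (auto simp: bdd_below_def)
  have "(f \<longlongrightarrow> L) at_top"
  proof (rule order_tendstoI)
    fix a assume a: "a < L"
    have "L \<le> f t" if "0 \<le> t" for t
      unfolding L_def using bdd that by (intro cInf_lower) auto
    then show "\<forall>\<^sub>F t in at_top. a < f t"
      by (intro eventually_mono[OF eventually_ge_at_top[of "0::real"]]) (use a in force)
  next
    fix a assume "L < a"
    then obtain s where s: "0 \<le> s" "f s < a"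
      unfolding L_def using cInf_lessD[of "f ` {0..}" a] by auto
    show "\<forall>\<^sub>F t in at_top. f t < a"
      using eventually_ge_at_top[of s] by eventually_elim (use dec s in force)
  qed
  then show ?thesis
    using tendsto_Lim[of at_top f L] by (simp add: ray_busemann_def f_def[abs_def])
qed

lemma tendsto_ray_busemann_seq:
  "(\<lambda>n. dist z (c (real n + h)) - (real n + h)) \<longlonglongrightarrow> ray_busemann c z"
  by (rule filterlim_compose[OF tendsto_ray_busemann]) real_asymp

lemma ray_busemann_le:
  assumes "0 \<le> t"
  shows "ray_busemann c z \<le> dist z (c t) - t"
proof (rule tendsto_upperbound[OF tendsto_ray_busemann])
  show "\<forall>\<^sub>F s in at_top. dist z (c s) - s \<le> dist z (c t) - t"
    using eventually_ge_at_top[of t]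
  proof eventually_elim
    case (elim s)
    then show ?case
      using dist_triangle[of z "c s" "c t"] unit_speed_onD[OF c, of t s] assms by simp
  qed
qed simp

lemma ray_busemann_lipschitz: "ray_busemann c z \<le> ray_busemann c w + dist z w"
proof (rule tendsto_le[OF _ tendsto_add[OF tendsto_ray_busemann tendsto_const] tendsto_ray_busemann])
  show "\<forall>\<^sub>F t in at_top. dist z (c t) - t \<le> dist w (c t) - t + dist z w"
    by (intro always_eventually allI) (smt (verit) dist_triangle)
qed simp

lemma ray_busemann_ge: "- dist z (c 0) \<le> ray_busemann c z"
proof (rule tendsto_lowerbound[OF tendsto_ray_busemann])
  show "\<forall>\<^sub>F t in at_top. - dist z (c 0) \<le> dist z (c t) - t"
    using eventually_ge_at_top[of 0]
  proof eventually_elim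
    case (elim t)
    then show ?case
      using dist_triangle[of "c 0" "c t" z] unit_speed_onD[OF c, of 0 t] by (simp add: dist_commute)
  qed
qed simp

lemma eventually_dist_less_ray_busemann:
  assumes "ray_busemann c z < r"
  shows "\<forall>\<^sub>F t in at_top. dist z (c t) < t + r"
  using order_tendstoD(2)[OF tendsto_ray_busemann assms] by eventually_elim simp

end

text \<open>Asymptoticity of rays can be checked at large integer parameters, since both rays have unit speed.\<close>

lemma bounded_dist_of_seq:
  assumes c: "unit_speed_on {0..} c" and c': "unit_speed_on {0..} c'"
    and K: "\<And>n. N \<le> n \<Longrightarrow> dist (c (real n)) (c' (real n)) \<le> K" and t: "0 \<le> t"
  shows "dist (c t) (c' t) \<le> K + 2 * (real N + 1)"
proof -
  define n where "n = nat \<lceil>t\<rceil> + N"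
  have n: "N \<le> n" "t \<le> real n" "real n - t \<le> real N + 1" using t by (auto simp: n_def) linarith+
  have "dist (c t) (c' t) \<le> dist (c t) (c n) + dist (c n) (c' n) + dist (c' n) (c' t)"
    by (smt (verit) dist_triangle)
  also have "\<dots> \<le> (real N + 1) + K + (real N + 1)"
    using unit_speed_onD[OF c, of t n] unit_speed_onD[OF c', of n t] K[OF n(1)] n t by simp
  finally show ?thesis by simp
qed

context proper_CAT_minus_one
begin

text \<open>The Gromov product of \<open>c s\<close> and \<open>c' s\<close> at the common origin tends to infinity, because their distance
  is bounded; so the rays agree.\<close>

lemma asymptotic_rays_eq:
  fixes c c' :: "real \<Rightarrow> 'a"
  assumes c: "unit_speed_on {0..} c" and c': "unit_speed_on {0..} c'" and 0: "c 0 = c' 0"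
    and B: "\<And>t. 0 \<le> t \<Longrightarrow> dist (c t) (c' t) \<le> B" and t: "0 \<le> t"
  shows "c t = c' t"
proof -
  have "((\<lambda>s. 1 + exp (2 * t - s - s + B)) \<longlongrightarrow> 1) at_top" by real_asymp
  moreover have "\<forall>\<^sub>F s in at_top. cosh (dist (c t) (c' t)) \<le> 1 + exp (2 * t - s - s + B)"
    using eventually_ge_at_top[of t]
  proof eventually_elim
    case (elim s)
    have "cosh (dist (c t) (c' t)) \<le> 1 + exp (2 * t - s - s + dist (c s) (c' s))"
      by (rule fellow_travel[OF unit_speed_on_subset[OF c] unit_speed_on_subset[OF c'] 0])
        (use elim t in auto)
    also have "\<dots> \<le> 1 + exp (2 * t - s - s + B)" using B[of s] elim t by simp
    finally show ?case .
  qed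
  ultimately have "cosh (dist (c t) (c' t)) \<le> 1" by (rule tendsto_lowerbound) simp
  then have "cosh (dist (c t) (c' t)) = 1" using cosh_real_ge_1 by (rule antisym)
  then show ?thesis by simp
qed

text \<open>The segments from \<open>p\<close> to \<open>c n\<close> converge because \<open>dist p (c n) - n\<close> converges, to \<open>ray_busemann c p\<close>: the
  defect \<open>\<eta> n\<close> of the path from \<open>p\<close> via \<open>c n\<close> to infinity tends to \<open>0\<close>. The same defect bounds the
  distance from \<open>c n\<close> to the limit ray, so that \<open>c'\<close> is even strongly asymptotic to \<open>c\<close>, with a shift of
  the parameter.\<close>

lemma ray_towards:
  fixes c :: "real \<Rightarrow> 'a" and p :: 'a
  assumes c: "unit_speed_on {0..} c"
  obtains c' where "unit_speed_on {0..} c'" "c' 0 = p"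
    "(\<lambda>n. dist (c' (real n + ray_busemann c p)) (c (real n))) \<longlonglongrightarrow> 0"
proof -
  define a where "a n = dist p (c (real n))" for n
  define h where "h = ray_busemann c p"
  define \<eta> where "\<eta> n = a n - real n - h" for n
  have "\<forall>n. \<exists>s. unit_speed_on {0..a n} s \<and> s 0 = p \<and> s (a n) = c (real n)"
    unfolding a_def by (metis segment_exists)
  then obtain \<sigma> where \<sigma>: "\<And>n. unit_speed_on {0..a n} (\<sigma> n)" "\<And>n. \<sigma> n 0 = p" "\<And>n. \<sigma> n (a n) = c (real n)"
    by metis
  have \<eta>0: "0 \<le> \<eta> n" for n
    using ray_busemann_le[OF c, of "real n" p] by (simp add: \<eta>_def h_def a_def)
  have "(\<lambda>n. dist p (c (real n + 0)) - (real n + 0) - h) \<longlonglongrightarrow> h - h"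
    unfolding h_def by (intro tendsto_diff tendsto_ray_busemann_seq[OF c] tendsto_const)
  then have \<eta>: "\<eta> \<longlonglongrightarrow> 0" by (simp add: \<eta>_def[abs_def] a_def)
  have "filterlim (\<lambda>n. real n + h) at_top sequentially" by real_asymp
  moreover have "\<forall>\<^sub>F n in sequentially. real n + h \<le> a n"
    using \<eta>0 by (intro always_eventually allI) (simp add: \<eta>_def algebra_simps)
  ultimately have a: "filterlim a at_top sequentially" by (rule filterlim_at_top_mono)
  obtain g where g: "unit_speed_on {t. \<exists>n::nat. 0 \<le> t} g"
    "\<And>n t. 0 \<le> t \<Longrightarrow> t \<le> a n \<Longrightarrow> cosh (dist (\<sigma> n t) (g t)) \<le> exp (2 * \<eta> n)"
  proof (rule segments_converge[of "\<lambda>_. 0" a \<sigma> \<eta>])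
    fix m n :: nat assume nm: "n \<le> m"
    have "dist (c (real n)) (c (real m)) = real m - real n"
      using unit_speed_onD[OF c, of "real n" "real m"] nm by simp
    then show "dist (\<sigma> n (a n)) (\<sigma> m (a m)) \<le> a m - a n + \<eta> n"
      using \<eta>0[of m] by (simp add: \<sigma>(3) \<eta>_def)
  qed (use \<sigma> \<eta>0 \<eta> a in \<open>auto simp: a_def decseq_def\<close>)
  have g': "unit_speed_on {0..} g" by (rule unit_speed_on_subset[OF g(1)]) auto
  show ?thesis
  proof (rule that[OF g'])
    have "(\<lambda>n::nat. dist p (g 0)) \<longlonglongrightarrow> 0"
    proof (rule tendsto_0_if_cosh_le[OF _ _ \<eta>])
      show "cosh (dist p (g 0)) \<le> exp (2 * \<eta> n)" for n
        using g(2)[of 0 n] \<sigma>(2)[of n] by (simp add: a_def)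
    qed simp
    then show "g 0 = p" by (simp add: LIMSEQ_const_iff)
    have "(\<lambda>n. dist (c (real n)) (g (a n))) \<longlonglongrightarrow> 0"
    proof (rule tendsto_0_if_cosh_le[OF _ _ \<eta>])
      show "cosh (dist (c (real n)) (g (a n))) \<le> exp (2 * \<eta> n)" for n
        using g(2)[of "a n" n] \<sigma>(3)[of n] by (simp add: a_def)
    qed simp
    then have lim: "(\<lambda>n. \<eta> n + dist (c (real n)) (g (a n))) \<longlonglongrightarrow> 0"
      using tendsto_add[OF \<eta>] by simp
    have "filterlim (\<lambda>n. real n + h) at_top sequentially" by real_asymp
    then have "\<forall>\<^sub>F n in sequentially. 0 \<le> real n + h" by (simp add: filterlim_at_top)
    then have "\<forall>\<^sub>F n in sequentially.
      norm (dist (g (real n + h)) (c (real n))) \<le> \<eta> n + dist (c (real n)) (g (a n))"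
    proof eventually_elim
      case (elim n)
      have "dist (g (real n + h)) (g (a n)) = \<eta> n"
        using unit_speed_onD[OF g', of "real n + h" "a n"] elim \<eta>0[of n] by (simp add: \<eta>_def a_def)
      then show ?case
        using dist_triangle[of "g (real n + h)" "c (real n)" "g (a n)"] by (simp add: dist_commute)
    qed
    then show "(\<lambda>n. dist (g (real n + ray_busemann c p)) (c (real n))) \<longlonglongrightarrow> 0"
      unfolding h_def[symmetric] using lim by (rule Lim_null_comparison)
  qed
qed

lemma asymptotic_ray_exists:
  fixes c :: "real \<Rightarrow> 'a" and p :: 'a
  assumes c: "unit_speed_on {0..} c"
  obtains c' B where "unit_speed_on {0..} c'" "c' 0 = p" "\<And>t. 0 \<le> t \<Longrightarrow> dist (c' t) (c t) \<le> B"
    "\<And>z. ray_busemann c' z = ray_busemann c z - ray_busemann c p"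
proof -
  define h where "h = ray_busemann c p"
  obtain c' where c': "unit_speed_on {0..} c'" "c' 0 = p"
    "(\<lambda>n. dist (c' (real n + h)) (c (real n))) \<longlonglongrightarrow> 0"
    unfolding h_def using ray_towards[OF c] by blast
  have "filterlim (\<lambda>n. real n + h) at_top sequentially" by real_asymp
  then have "\<forall>\<^sub>F n in sequentially. 0 \<le> real n + h" by (simp add: filterlim_at_top)
  moreover have "\<forall>\<^sub>F n in sequentially. dist (c' (real n + h)) (c (real n)) < 1"
    using c'(3) by (rule order_tendstoD) simp
  ultimately have "\<forall>\<^sub>F n in sequentially. dist (c' (real n)) (c (real n)) \<le> \<bar>h\<bar> + 1"
  proof eventually_elim
    case (elim n)
    have "dist (c' (real n)) (c' (real n + h)) = \<bar>h\<bar>"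
      using unit_speed_onD[OF c'(1), of "real n" "real n + h"] elim by simp
    then show ?case
      using elim dist_triangle[of "c' (real n)" "c (real n)" "c' (real n + h)"] by simp
  qed
  then obtain N where N: "\<And>n. N \<le> n \<Longrightarrow> dist (c' (real n)) (c (real n)) \<le> \<bar>h\<bar> + 1"
    unfolding eventually_sequentially by blast
  show ?thesis
  proof (rule that[OF c'(1,2)])
    show "dist (c' t) (c t) \<le> \<bar>h\<bar> + 1 + 2 * (real N + 1)" if "0 \<le> t" for t
      using bounded_dist_of_seq[OF c'(1) c N that] .
    fix z
    have 1: "(\<lambda>n. dist z (c' (real n + h)) - (real n + h)) \<longlonglongrightarrow> ray_busemann c' z"
      by (rule tendsto_ray_busemann_seq[OF c'(1)])
    have 2: "(\<lambda>n. (dist z (c (real n + 0)) - (real n + 0)) - h) \<longlonglongrightarrow> ray_busemann c z - h"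
      by (intro tendsto_diff tendsto_const tendsto_ray_busemann_seq[OF c])
    have "(\<lambda>n. (dist z (c' (real n + h)) - (real n + h)) - ((dist z (c (real n + 0)) - (real n + 0)) - h)) \<longlonglongrightarrow> 0"
      by (rule Lim_null_comparison[OF _ c'(3)], intro always_eventually allI)
        (smt (verit) abs_dist_diff_le dist_commute real_norm_def)
    moreover have "(\<lambda>n. (dist z (c' (real n + h)) - (real n + h)) - ((dist z (c (real n + 0)) - (real n + 0)) - h))
      \<longlonglongrightarrow> ray_busemann c' z - (ray_busemann c z - h)"
      by (rule tendsto_diff[OF 1 2])
    ultimately show "ray_busemann c' z = ray_busemann c z - ray_busemann c p"
      using LIMSEQ_unique unfolding h_def[symmetric] by fastforce
  qed
qed

text \<open>Uniqueness of the ray from a given point identifies \<open>c'\<close> with the ray that \<open>asymptotic_ray_exists\<close>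
  constructs, for which the Busemann function is known.\<close>

lemma ray_busemann_asymptotic:
  fixes c c' :: "real \<Rightarrow> 'a"
  assumes c: "unit_speed_on {0..} c" and c': "unit_speed_on {0..} c'"
    and B: "\<And>t. 0 \<le> t \<Longrightarrow> dist (c t) (c' t) \<le> B"
  shows "ray_busemann c' z = ray_busemann c z - ray_busemann c (c' 0)"
proof -
  obtain c'' B' where c'': "unit_speed_on {0..} c''" "c'' 0 = c' 0"
    "\<And>t. 0 \<le> t \<Longrightarrow> dist (c'' t) (c t) \<le> B'"
    "\<And>z. ray_busemann c'' z = ray_busemann c z - ray_busemann c (c' 0)"
    using asymptotic_ray_exists[OF c] by blast
  have "c'' t = c' t" if "0 \<le> t" for t
  proof (rule asymptotic_rays_eq[OF c''(1) c' c''(2) _ that])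
    show "dist (c'' t) (c' t) \<le> B' + B" if "0 \<le> t" for t
      using c''(3)[OF that] B[OF that] dist_triangle[of "c'' t" "c' t" "c t"] by linarith
  qed
  then show ?thesis using ray_busemann_cong[of c'' c'] c''(4) by metis
qed

text \<open>The line is the limit of the segments from \<open>c' n\<close> to \<open>c n\<close>. The number \<open>e n\<close> is twice the Gromov product
  of their ends at the common origin. It increases by the triangle inequality and is bounded, because
  otherwise \<open>fellow_travel\<close> would force the rays to agree. Hence it converges, and the path
  from \<open>c' m\<close> via \<open>c' n\<close> and \<open>c n\<close> to \<open>c m\<close> is geodesic up to the defect \<open>e m - e n\<close>. The \<open>n\<close>-th segment
  is parametrized on \<open>{- n..n - e n}\<close>, which matches the parameters along \<open>c'\<close>.\<close>

lemma line_between_rays: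
  fixes c c' :: "real \<Rightarrow> 'a"
  assumes c: "unit_speed_on {0..} c" and c': "unit_speed_on {0..} c'" and 0: "c 0 = c' 0"
    and distinct: "0 \<le> r" "c r \<noteq> c' r"
  obtains g B where "unit_speed_on UNIV g"
    "\<And>t. 0 \<le> t \<Longrightarrow> dist (g t) (c t) \<le> B" "\<And>t. 0 \<le> t \<Longrightarrow> dist (g (- t)) (c' t) \<le> B"
proof -
  define L where "L n = dist (c' (real n)) (c (real n))" for n
  define e where "e n = 2 * real n - L n" for n
  have e_mono: "e n \<le> e m" if "n \<le> m" for n m
  proof -
    have "dist (c (real n)) (c (real m)) = real m - real n" "dist (c' (real n)) (c' (real m)) = real m - real n"
      using unit_speed_onD[OF c, of "real n" "real m"] unit_speed_onD[OF c', of "real n" "real m"] that by auto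
    then have "L m \<le> L n + 2 * (real m - real n)"
      using dist_triangle[of "c' (real m)" "c (real m)" "c' (real n)"]
        dist_triangle[of "c' (real n)" "c (real m)" "c (real n)"]
      unfolding L_def by (simp add: dist_commute)
    then show ?thesis by (simp add: e_def algebra_simps)
  qed
  have "1 < cosh (dist (c r) (c' r))"
    using distinct cosh_real_nonneg_less_iff[of 0 "dist (c r) (c' r)"] by simp
  then have d: "0 < cosh (dist (c r) (c' r)) - 1" by simp
  have e_bound: "e n \<le> 2 * r - ln (cosh (dist (c r) (c' r)) - 1)" for n
  proof -
    define m where "m = max n (nat \<lceil>r\<rceil>)"
    have m: "n \<le> m" "r \<le> real m" by (auto simp: m_def) linarith
    have "cosh (dist (c r) (c' r)) \<le> 1 + exp (2 * r - m - m + dist (c (real m)) (c' (real m)))"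
      by (rule fellow_travel[OF unit_speed_on_subset[OF c] unit_speed_on_subset[OF c'] 0])
        (use m distinct in auto)
    then have "cosh (dist (c r) (c' r)) - 1 \<le> exp (2 * r - e m)"
      by (simp add: e_def L_def dist_commute algebra_simps)
    then have "ln (cosh (dist (c r) (c' r)) - 1) \<le> 2 * r - e m"
      using d by (metis ln_exp ln_le_cancel_iff exp_gt_zero)
    then show ?thesis using e_mono[OF m(1)] by simp
  qed
  obtain E where E: "e \<longlonglongrightarrow> E" "\<And>n. e n \<le> E"
    using incseq_convergent[of e] e_bound e_mono by (auto simp: incseq_def)
  define \<eta> where "\<eta> n = E - e n" for n
  have \<eta>0: "0 \<le> \<eta> n" for n using E(2) by (simp add: \<eta>_def)
  have \<eta>: "\<eta> \<longlonglongrightarrow> 0" using tendsto_diff[OF tendsto_const E(1), of E] by (simp add: \<eta>_def[abs_def])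
  have "\<forall>n. \<exists>s. unit_speed_on {0..L n} s \<and> s 0 = c' (real n) \<and> s (L n) = c (real n)"
    unfolding L_def by (metis segment_exists)
  then obtain s where s: "\<And>n. unit_speed_on {0..L n} (s n)" "\<And>n. s n 0 = c' (real n)" "\<And>n. s n (L n) = c (real n)"
    by metis
  define \<sigma> where "\<sigma> n t = s n (real n + t)" for n t
  have \<sigma>: "\<sigma> n (- real n) = c' (real n)" "\<sigma> n (real n - e n) = c (real n)" for n
    by (simp_all add: \<sigma>_def s e_def)
  have L: "- real n \<le> real n - e n" for n by (simp add: e_def L_def)
  obtain g where g: "unit_speed_on {t. \<exists>n. - real n \<le> t} g"
    "\<And>n t. - real n \<le> t \<Longrightarrow> t \<le> real n - e n \<Longrightarrow> cosh (dist (\<sigma> n t) (g t)) \<le> exp (2 * \<eta> n)"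
  proof (rule segments_converge[of "\<lambda>n. - real n" "\<lambda>n. real n - e n" \<sigma> \<eta>])
    show "unit_speed_on {- real n..real n - e n} (\<sigma> n)" for n
      unfolding \<sigma>_def by (rule unit_speed_on_shift[OF s(1)]) (auto simp: e_def)
    fix m n :: nat assume nm: "n \<le> m"
    have d: "dist (c (real n)) (c (real m)) = real m - real n" "dist (c' (real n)) (c' (real m)) = real m - real n"
      using unit_speed_onD[OF c, of "real n" "real m"] unit_speed_onD[OF c', of "real n" "real m"] nm by auto
    show "dist (\<sigma> n (- real n)) (\<sigma> m (- real m)) \<le> - real n - - real m + \<eta> n"
      using d \<eta>0[of n] by (simp add: \<sigma>)
    show "dist (\<sigma> n (real n - e n)) (\<sigma> m (real m - e m)) \<le> (real m - e m) - (real n - e n) + \<eta> n"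
      using d \<eta>0[of m] by (simp add: \<sigma> \<eta>_def)
  next
    have "filterlim (\<lambda>n. real n - E) at_top sequentially" by real_asymp
    then show "filterlim (\<lambda>n. real n - e n) at_top sequentially"
      by (rule filterlim_at_top_mono) (use E(2) in \<open>auto intro: always_eventually\<close>)
  qed (use L \<eta>0 \<eta> in \<open>auto simp: decseq_def\<close>)
  have g': "unit_speed_on UNIV g"
  proof (rule unit_speed_on_subset[OF g(1)], rule subsetI, rule CollectI)
    show "\<exists>n. - real n \<le> t" for t using real_arch_simple[of "- t"] by (metis minus_le_iff)
  qed
  have small: "x \<le> exp (2 * \<eta> 0)" if "cosh x \<le> exp (2 * \<eta> n)" "0 \<le> x" for n x
  proof -
    have "x \<le> cosh x" using real_le_x_sinh[OF that(2)] sinh_le_cosh_real[of x] by (simp add: sinh_field_def exp_minus)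
    moreover have "exp (2 * \<eta> n) \<le> exp (2 * \<eta> 0)" using e_mono[of 0 n] by (simp add: \<eta>_def)
    ultimately show ?thesis using that by linarith
  qed
  define E' where "E' = \<bar>E\<bar> + \<bar>e 0\<bar>"
  have e_abs: "\<bar>e n\<bar> \<le> E'" for n using E(2)[of n] e_mono[of 0 n] by (simp add: E'_def)
  have plus: "dist (g (real n)) (c (real n)) \<le> E' + exp (2 * \<eta> 0)" for n
  proof -
    have "dist (c (real n)) (g (real n - e n)) \<le> exp (2 * \<eta> 0)"
      using small[OF g(2)[OF L order_refl]] by (simp add: \<sigma>)
    moreover have "dist (g (real n)) (g (real n - e n)) \<le> E'"
      using unit_speed_onD[OF g', of "real n" "real n - e n"] e_abs[of n] by simp
    ultimately show ?thesis
      using dist_triangle[of "g (real n)" "c (real n)" "g (real n - e n)"] by (simp add: dist_commute)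
  qed
  have minus: "dist (g (0 - real n)) (c' (real n)) \<le> E' + exp (2 * \<eta> 0)" for n
  proof -
    have "dist (c' (real n)) (g (- real n)) \<le> exp (2 * \<eta> 0)"
      using small[OF g(2)[OF order_refl L]] by (simp add: \<sigma>)
    then show ?thesis by (simp add: dist_commute E'_def)
  qed
  have r: "unit_speed_on {0..} (\<lambda>t. g (0 - t))" by (rule unit_speed_on_reflect[OF g']) simp
  show ?thesis
  proof (rule that[OF g'])
    show "dist (g t) (c t) \<le> E' + exp (2 * \<eta> 0) + 2 * (real 0 + 1)" if "0 \<le> t" for t
      by (rule bounded_dist_of_seq[OF unit_speed_on_subset[OF g'] c plus that]) simp
    show "dist (g (- t)) (c' t) \<le> E' + exp (2 * \<eta> 0) + 2 * (real 0 + 1)" if "0 \<le> t" for t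
      using bounded_dist_of_seq[OF r c', of 0, OF minus that] by simp
  qed
qed

end

section \<open>Busemann functions of geodesic lines\<close>

abbreviation (input) reverse :: "(real \<Rightarrow> 'a) \<Rightarrow> real \<Rightarrow> 'a" where
  "reverse g \<equiv> \<lambda>t. g (- t)"

text \<open>The representative, normalised at \<open>g 0\<close>, of the boundary point that \<open>g\<close> determines.\<close>

definition max_busemann :: "(real \<Rightarrow> 'a::metric_space) \<Rightarrow> 'a \<times> 'a \<Rightarrow> real" where
  "max_busemann g w = max (ray_busemann g (fst w)) (ray_busemann (reverse g) (snd w))"

lemma line_imp_ray: "unit_speed_on UNIV g \<Longrightarrow> unit_speed_on {0..} g"
  by (rule unit_speed_on_subset) auto

lemma reverse_line: "unit_speed_on UNIV g \<Longrightarrow> unit_speed_on UNIV (reverse g)"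
  using unit_speed_on_reflect[of UNIV g UNIV 0] by simp

lemma ray_busemann_on_line:
  assumes g: "unit_speed_on UNIV g"
  shows "ray_busemann g (g s) = - s"
proof -
  have "\<forall>\<^sub>F t in at_top. dist (g s) (g t) - t = - s"
    using eventually_ge_at_top[of s] by eventually_elim (simp add: unit_speed_onD[OF g])
  then have "((\<lambda>t. dist (g s) (g t) - t) \<longlongrightarrow> - s) at_top" by (rule tendsto_eventually)
  then show ?thesis
    by (rule tendsto_unique[OF _ tendsto_ray_busemann[OF line_imp_ray[OF g]], rotated]) simp
qed

lemma ray_busemann_reverse_on_line:
  "unit_speed_on UNIV g \<Longrightarrow> ray_busemann (reverse g) (g s) = s"
  using ray_busemann_on_line[OF reverse_line, of g "- s"] by simp

lemma ray_busemann_shift: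
  assumes c: "unit_speed_on {0..} c"
  shows "ray_busemann (\<lambda>t. c (a + t)) z = ray_busemann c z + a"
proof -
  have "((\<lambda>t. dist z (c (a + t)) - (a + t)) \<longlongrightarrow> ray_busemann c z) at_top"
    by (rule filterlim_compose[OF tendsto_ray_busemann[OF c]]) real_asymp
  then have "((\<lambda>t. (dist z (c (a + t)) - (a + t)) + a) \<longlongrightarrow> ray_busemann c z + a) at_top"
    by (intro tendsto_intros)
  then show ?thesis unfolding ray_busemann_def[of "\<lambda>t. c (a + t)"] by (intro tendsto_Lim) simp_all
qed

lemma ray_busemann_sum_nonneg:
  assumes g: "unit_speed_on UNIV g"
  shows "0 \<le> ray_busemann g z + ray_busemann (reverse g) z"
proof (rule tendsto_lowerbound)
  show "((\<lambda>t. (dist z (g t) - t) + (dist z (reverse g t) - t)) \<longlongrightarrow>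
      ray_busemann g z + ray_busemann (reverse g) z) at_top"
    using g by (intro tendsto_add tendsto_ray_busemann line_imp_ray reverse_line)
  show "\<forall>\<^sub>F t in at_top. 0 \<le> (dist z (g t) - t) + (dist z (reverse g t) - t)"
    using eventually_ge_at_top[of 0]
  proof eventually_elim
    case (elim t)
    have "dist (g t) (g (- t)) = 2 * t" using unit_speed_onD[OF g, of t "- t"] elim by simp
    then show ?case using dist_triangle[of "g t" "g (- t)" z] by (simp add: dist_commute)
  qed
qed simp

lemma abs_max_diff_le:
  fixes a b a' b' e :: real
  shows "\<bar>a' - a\<bar> \<le> e \<Longrightarrow> \<bar>b' - b\<bar> \<le> e \<Longrightarrow> \<bar>max a' b' - max a b\<bar> \<le> e"
  by linarith

text \<open>At \<open>z' = g (- R)\<close> the second Busemann function of \<open>g\<close> has the value \<open>- R\<close>, which is below the values of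
  the first one at all points \<open>z\<close> of a slightly smaller ball; so the maximum is the first one there. For
  \<open>g'\<close> it has to be shown that the maximum is not attained by the second Busemann function at
  \<open>g (- R)\<close>: the pair \<open>(g R, g (- R))\<close>, at which both functions of \<open>g\<close> are \<open>- R\<close>, bounds that value.\<close>

lemma ray_busemann_close_if_max_close:
  assumes g: "unit_speed_on UNIV g" and g': "unit_speed_on UNIV g'"
    and close: "\<And>z z'. dist z (g 0) \<le> R \<Longrightarrow> dist z' (g 0) \<le> R \<Longrightarrow>
      \<bar>max (ray_busemann g' z) (ray_busemann (reverse g') z') -
       max (ray_busemann g z) (ray_busemann (reverse g) z') - k\<bar> \<le> e"
    and z: "dist z (g 0) + 2 * e < R" and e: "0 \<le> e"
  shows "\<bar>ray_busemann g' z - ray_busemann g z - k\<bar> \<le> e"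
proof -
  have R: "0 \<le> R" "dist z (g 0) \<le> R" using z e zero_le_dist[of z "g 0"] by linarith+
  have d: "dist (g R) (g 0) \<le> R" "dist (g (- R)) (g 0) \<le> R" using R by (simp_all add: unit_speed_onD[OF g])
  have v: "ray_busemann (reverse g) (g (- R)) = - R" "ray_busemann g (g R) = - R"
    using ray_busemann_on_line[OF g] ray_busemann_reverse_on_line[OF g] by auto
  have "- dist z (g 0) \<le> ray_busemann g z" using ray_busemann_ge[OF line_imp_ray[OF g]] .
  moreover note close[OF R(2) d(2)] close[OF d]
  ultimately show ?thesis using z e unfolding v by linarith
qed

lemma exp_le_twice_cosh: "exp x \<le> 2 * cosh (x::real)"
  by (simp add: cosh_field_def)

context proper_CAT_minus_one
begin

text \<open>Combined with \<open>ray_busemann_sum_nonneg\<close>, the case \<open>\<eta> = 0\<close> says that \<open>g t\<close> is the only point at which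
  the two Busemann functions are \<open>- t\<close> and \<open>t\<close>. It holds because the hypotheses make \<open>z\<close> almost a
  point between \<open>g (- s)\<close> and \<open>g s\<close> for all large \<open>s\<close>.\<close>

lemma near_line:
  fixes g :: "real \<Rightarrow> 'a"
  assumes g: "unit_speed_on UNIV g"
    and u: "ray_busemann g z \<le> - t + \<eta>" and v: "ray_busemann (reverse g) z \<le> t + \<eta>"
  shows "cosh (dist z (g t)) \<le> exp (2 * \<eta>)"
proof (rule tendsto_lowerbound)
  show "((\<lambda>\<eta>'. exp (2 * \<eta>')) \<longlongrightarrow> exp (2 * \<eta>)) (at_right \<eta>)" by (intro tendsto_intros)
  have "cosh (dist z (g t)) \<le> exp (2 * \<eta>')" if "\<eta> < \<eta>'" for \<eta>'
  proof -
    have "ray_busemann g z < - t + \<eta>'" "ray_busemann (reverse g) z < t + \<eta>'" using u v that by auto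
    then have "\<forall>\<^sub>F s in at_top. dist z (g s) < s + (- t + \<eta>')"
      "\<forall>\<^sub>F s in at_top. dist z (reverse g s) < s + (t + \<eta>')"
      using g by (simp_all only: eventually_dist_less_ray_busemann line_imp_ray reverse_line)
    then have "\<forall>\<^sub>F s::real in at_top. cosh (dist z (g t)) \<le> exp (2 * \<eta>')"
      using eventually_ge_at_top[of "\<bar>t\<bar> + 1"]
    proof eventually_elim
      case (elim s)
      have "0 \<le> \<eta>'" using ray_busemann_sum_nonneg[OF g, of z] u v that by linarith
      then show ?case
        by (intro almost_between[of "- s" s g t \<eta>' z] unit_speed_on_subset[OF g]) (use elim in auto)
    qed
    then show ?thesis by simp
  qed
  then show "\<forall>\<^sub>F \<eta>' in at_right \<eta>. cosh (dist z (g t)) \<le> exp (2 * \<eta>')"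
    using eventually_at_right_less[of \<eta>] by (auto elim: eventually_mono)
qed simp

text \<open>If moving from \<open>c 0\<close> to \<open>c 5\<close> decreases the Busemann function of \<open>c'\<close> almost as fast as possible, then
  distant points of \<open>c'\<close> are seen from \<open>c 0\<close> in a direction close to that of \<open>c\<close>. The numbers are chosen
  such that the Gromov product of \<open>c 5\<close> and \<open>c' n\<close> at \<open>c 0\<close> exceeds \<open>2\<close> by enough to make the distance
  at parameter \<open>2\<close> at most \<open>1\<close>.\<close>

lemma segment_follows_ray:
  fixes c c' :: "real \<Rightarrow> 'a"
  assumes c: "unit_speed_on {0..} c" and c': "unit_speed_on {0..} c'"
    and drop: "ray_busemann c' (c 5) \<le> ray_busemann c' (c 0) - 3"
  shows "\<forall>\<^sub>F n in at_top. \<forall>\<sigma>. unit_speed_on {0..dist (c 0) (c' n)} \<sigma> \<and> \<sigma> 0 = c 0 \<and>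
    \<sigma> (dist (c 0) (c' n)) = c' n \<longrightarrow> 2 \<le> dist (c 0) (c' n) \<and> dist (c 2) (\<sigma> 2) \<le> 1"
proof -
  have "\<forall>\<^sub>F n in at_top. dist (c 5) (c' n) < n + (ray_busemann c' (c 5) + 1 / 2)"
    by (rule eventually_dist_less_ray_busemann[OF c']) simp
  then show ?thesis
    using eventually_ge_at_top[of "max 0 (2 - ray_busemann c' (c 0))"]
  proof (eventually_elim, intro allI impI)
    fix n \<sigma> assume elim: "dist (c 5) (c' n) < n + (ray_busemann c' (c 5) + 1 / 2)"
      "max 0 (2 - ray_busemann c' (c 0)) \<le> n"
      "unit_speed_on {0..dist (c 0) (c' n)} \<sigma> \<and> \<sigma> 0 = c 0 \<and> \<sigma> (dist (c 0) (c' n)) = c' n"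
    define a where "a = dist (c 0) (c' n)"
    have a: "ray_busemann c' (c 0) + n \<le> a"
      using ray_busemann_le[OF c', of n "c 0"] elim by (simp add: a_def)
    have 2: "2 \<le> a" using a elim by simp
    have "cosh (dist (c 2) (\<sigma> 2)) \<le> 1 + exp (2 * 2 - 5 - a + dist (c 5) (\<sigma> a))"
      by (rule fellow_travel[OF unit_speed_on_subset[OF c]]) (use elim 2 in \<open>auto simp: a_def\<close>)
    also have "\<dots> \<le> 1 + exp (- 3)"
      using elim a drop by (simp add: a_def)
    also have "\<dots> \<le> cosh 1"
    proof -
      have "1 + 3 \<le> exp (3::real)" by (rule exp_ge_add_one_self)
      then have "exp (- 3) \<le> (1/4::real)" by (simp add: exp_minus field_simps)
      moreover have "1 + 1 + 1\<^sup>2 / 2 \<le> exp (1::real)" by (rule exp_lower_Taylor_quadratic) simp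
      ultimately show ?thesis using exp_le_twice_cosh[of 1] by simp
    qed
    finally have "dist (c 2) (\<sigma> 2) \<le> 1" by (simp add: cosh_real_nonneg_le_iff)
    with 2 show "2 \<le> dist (c 0) (c' n) \<and> dist (c 2) (\<sigma> 2) \<le> 1" by (simp add: a_def)
  qed
qed

text \<open>The sum of the two Busemann functions of \<open>g'\<close> at \<open>g 0\<close> is at most twice the Gromov product of
  \<open>g' n\<close> and \<open>g' (- n)\<close>. Seen from \<open>g 0\<close> these two points lie in almost opposite directions, those of
  the ends of \<open>g\<close>, and therefore \<open>fellow_travel\<close> bounds the product. So \<open>g'\<close> passes near \<open>g 0\<close>, although
  the hypotheses speak only of points on \<open>g\<close>.\<close>

lemma ray_busemann_sum_le_four:
  fixes g g' :: "real \<Rightarrow> 'a"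
  assumes g: "unit_speed_on UNIV g" and g': "unit_speed_on UNIV g'"
    and drop: "ray_busemann g' (g 5) \<le> ray_busemann g' (g 0) - 3"
      "ray_busemann (reverse g') (g (- 5)) \<le> ray_busemann (reverse g') (g 0) - 3"
  shows "ray_busemann g' (g 0) + ray_busemann (reverse g') (g 0) \<le> 4"
proof -
  note rays = line_imp_ray[OF g] line_imp_ray[OF g']
    line_imp_ray[OF reverse_line[OF g]] line_imp_ray[OF reverse_line[OF g']]
  define x\<^sub>0 where "x\<^sub>0 = g 0"
  have "\<forall>\<^sub>F n in at_top. 0 \<le> n \<and>
    (\<forall>\<sigma>. unit_speed_on {0..dist x\<^sub>0 (g' n)} \<sigma> \<and> \<sigma> 0 = x\<^sub>0 \<and>
      \<sigma> (dist x\<^sub>0 (g' n)) = g' n \<longrightarrow> 2 \<le> dist x\<^sub>0 (g' n) \<and> dist (g 2) (\<sigma> 2) \<le> 1) \<and>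
    (\<forall>\<sigma>. unit_speed_on {0..dist x\<^sub>0 (g' (- n))} \<sigma> \<and> \<sigma> 0 = x\<^sub>0 \<and>
      \<sigma> (dist x\<^sub>0 (g' (- n))) = g' (- n) \<longrightarrow> 2 \<le> dist x\<^sub>0 (g' (- n)) \<and> dist (g (- 2)) (\<sigma> 2) \<le> 1)"
    using segment_follows_ray[OF rays(1,2) drop(1)] segment_follows_ray[OF rays(3,4)] drop(2)
      eventually_ge_at_top[of "0::real"]
    by (simp add: x\<^sub>0_def eventually_conj_iff)
  then obtain n where n: "0 \<le> n"
    "\<And>\<sigma>. unit_speed_on {0..dist x\<^sub>0 (g' n)} \<sigma> \<Longrightarrow> \<sigma> 0 = x\<^sub>0 \<Longrightarrow>
      \<sigma> (dist x\<^sub>0 (g' n)) = g' n \<Longrightarrow> 2 \<le> dist x\<^sub>0 (g' n) \<and> dist (g 2) (\<sigma> 2) \<le> 1"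
    "\<And>\<sigma>. unit_speed_on {0..dist x\<^sub>0 (g' (- n))} \<sigma> \<Longrightarrow> \<sigma> 0 = x\<^sub>0 \<Longrightarrow>
      \<sigma> (dist x\<^sub>0 (g' (- n))) = g' (- n) \<Longrightarrow> 2 \<le> dist x\<^sub>0 (g' (- n)) \<and> dist (g (- 2)) (\<sigma> 2) \<le> 1"
    by (auto dest!: eventually_happens)
  define a b where "a = dist x\<^sub>0 (g' n)" and "b = dist x\<^sub>0 (g' (- n))"
  obtain \<sigma> where \<sigma>: "unit_speed_on {0..a} \<sigma>" "\<sigma> 0 = x\<^sub>0" "\<sigma> a = g' n"
    unfolding a_def by (rule segment_exists)
  obtain \<tau> where \<tau>: "unit_speed_on {0..b} \<tau>" "\<tau> 0 = x\<^sub>0" "\<tau> b = g' (- n)"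
    unfolding b_def by (rule segment_exists)
  have close: "2 \<le> a" "dist (g 2) (\<sigma> 2) \<le> 1" "2 \<le> b" "dist (g (- 2)) (\<tau> 2) \<le> 1"
    using n(2)[of \<sigma>] n(3)[of \<tau>] \<sigma> \<tau> by (auto simp: a_def b_def)
  have "dist (g 2) (g (- 2)) = 4" by (simp add: unit_speed_onD[OF g])
  then have far: "2 \<le> dist (\<sigma> 2) (\<tau> 2)"
    using close dist_triangle[of "g 2" "g (- 2)" "\<sigma> 2"] dist_triangle[of "\<sigma> 2" "g (- 2)" "\<tau> 2"]
    by (simp add: dist_commute)
  have "1 + 2 + 2\<^sup>2 / 2 \<le> exp (2::real)" by (rule exp_lower_Taylor_quadratic) simp
  then have "1 + 1 \<le> cosh (2::real)" using exp_le_twice_cosh[of 2] by simp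
  also have "\<dots> \<le> cosh (dist (\<sigma> 2) (\<tau> 2))" using far by (simp add: cosh_real_nonneg_le_iff)
  also have "\<dots> \<le> 1 + exp (2 * 2 - a - b + dist (\<sigma> a) (\<tau> b))"
    by (rule fellow_travel[OF \<sigma>(1) \<tau>(1)]) (use \<sigma> \<tau> close in auto)
  also have "dist (\<sigma> a) (\<tau> b) = 2 * n" using n(1) by (simp add: \<sigma> \<tau> unit_speed_onD[OF g'])
  finally have "a + b - 2 * n \<le> 4" by simp
  moreover have "ray_busemann g' x\<^sub>0 \<le> a - n" "ray_busemann (reverse g') x\<^sub>0 \<le> b - n"
    using ray_busemann_le[OF rays(2) n(1)] ray_busemann_le[OF rays(4) n(1)] by (auto simp: a_def b_def)
  ultimately show ?thesis by (simp add: x\<^sub>0_def)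
qed

text \<open>The two Busemann functions of \<open>g'\<close> differ from those of \<open>g\<close> by \<open>k\<close> up to \<open>e\<close> on a ball. The sum of
  the two functions vanishes on the line and is nonnegative elsewhere, for \<open>g\<close> as for \<open>g'\<close>. At \<open>g 0\<close> this
  gives \<open>- e \<le> k\<close>; at a point of \<open>g'\<close> in the ball it gives \<open>k \<le> e\<close>, but first such a point must be found,
  which is where \<open>ray_busemann_sum_le_four\<close> is needed. Now \<open>k\<close> is small, and the functions of \<open>g\<close> are
  known at \<open>g' t\<close> up to \<open>2 * e\<close>; this places \<open>g' t\<close> near \<open>g t\<close>.\<close>

lemma lines_close_if_max_busemann_close:
  fixes g g' :: "real \<Rightarrow> 'a"
  assumes g: "unit_speed_on UNIV g" and g': "unit_speed_on UNIV g'"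
    and e: "0 \<le> e" "e \<le> 1" and t: "\<bar>t\<bar> \<le> T"
    and close: "\<And>z z'. dist z (g 0) \<le> T + 15 \<Longrightarrow> dist z' (g 0) \<le> T + 15 \<Longrightarrow>
      \<bar>max_busemann g' (z, z') - max_busemann g (z, z') - k\<bar> \<le> e"
  shows "cosh (dist (g' t) (g t)) \<le> exp (4 * e)"
proof -
  let ?u = "ray_busemann g" and ?v = "ray_busemann (reverse g)"
  let ?u' = "ray_busemann g'" and ?v' = "ray_busemann (reverse g')"
  \<comment> \<open>The radius \<open>T + 12\<close> leaves room for \<open>g 5\<close>, \<open>g (- 5)\<close>, \<open>g' t\<^sub>0\<close> and \<open>g' t\<close> below; passing from the maximum
    to the single functions costs \<open>2 * e < 3\<close> of the radius.\<close>
  have u: "\<bar>?u' z - ?u z - k\<bar> \<le> e" if "dist z (g 0) \<le> T + 12" for z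
    by (rule ray_busemann_close_if_max_close[OF g g', of "T + 15"])
      (use close that e in \<open>auto simp: max_busemann_def\<close>)
  have v: "\<bar>?v' z - ?v z - k\<bar> \<le> e" if "dist z (g 0) \<le> T + 12" for z
  proof (rule ray_busemann_close_if_max_close[OF reverse_line[OF g] reverse_line[OF g'], of "T + 15"])
    show "\<bar>max (?v' z) (ray_busemann (reverse (reverse g')) z') -
       max (?v z) (ray_busemann (reverse (reverse g)) z') - k\<bar> \<le> e"
      if "dist z (g (- 0)) \<le> T + 15" "dist z' (g (- 0)) \<le> T + 15" for z z'
      using close[of z' z] that by (simp add: max_busemann_def max.commute)
  qed (use that e in auto)
  note line = ray_busemann_on_line[OF g] ray_busemann_reverse_on_line[OF g]
  note line' = ray_busemann_on_line[OF g'] ray_busemann_reverse_on_line[OF g']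
  have T: "0 \<le> T" using t by linarith
  have d: "dist (g 0) (g 0) \<le> T + 12" "dist (g 5) (g 0) \<le> T + 12" "dist (g (- 5)) (g 0) \<le> T + 12"
    using T by (simp_all add: unit_speed_onD[OF g])
  have "?u' (g 5) \<le> ?u' (g 0) - 3" "?v' (g (- 5)) \<le> ?v' (g 0) - 3"
    using u[OF d(1)] u[OF d(2)] v[OF d(1)] v[OF d(3)] e unfolding line by linarith+
  then have "?u' (g 0) + ?v' (g 0) \<le> 4" by (rule ray_busemann_sum_le_four[OF g g'])
  moreover have "0 \<le> ?u' (g 0) + ?v' (g 0)" by (rule ray_busemann_sum_nonneg[OF g'])
  \<comment> \<open>The two functions of \<open>g'\<close> at \<open>g 0\<close> are \<open>- t\<^sub>0\<close> and \<open>t\<^sub>0\<close>, both up to half of their sum, hence up to \<open>2\<close>.\<close>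
  moreover define t\<^sub>0 where "t\<^sub>0 = (?v' (g 0) - ?u' (g 0)) / 2"
  ultimately have "?u' (g 0) \<le> - t\<^sub>0 + 2" "?v' (g 0) \<le> t\<^sub>0 + 2" and k: "- e \<le> k"
    using u[OF d(1)] v[OF d(1)] by (simp_all add: line)
  then have "cosh (dist (g 0) (g' t\<^sub>0)) \<le> exp (2 * 2)" by (intro near_line[OF g'])
  also have "\<dots> \<le> cosh (5::real)"
  proof -
    have "2 \<le> exp (1::real)" using exp_ge_add_one_self[of "1::real"] by simp
    then have "2 * exp 4 \<le> exp 1 * exp (4::real)" by (intro mult_right_mono) auto
    also have "\<dots> = exp 5" by (simp add: exp_add[symmetric])
    finally show ?thesis using exp_le_twice_cosh[of 5] by simp
  qed
  finally have near: "dist (g 0) (g' t\<^sub>0) \<le> 5" by (simp add: cosh_real_nonneg_le_iff)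
  then have "dist (g' t\<^sub>0) (g 0) \<le> T + 12" using T by (simp add: dist_commute)
  from u[OF this] v[OF this] have k': "k \<le> e"
    using ray_busemann_sum_nonneg[OF g, of "g' t\<^sub>0"] unfolding line' by linarith
  have "\<bar>t\<^sub>0\<bar> \<le> 2" using u[OF d(1)] v[OF d(1)] k k' e
    by (simp add: t\<^sub>0_def line abs_le_iff)
  then have "dist (g' t) (g 0) \<le> T + 12"
    using near t dist_triangle[of "g' t" "g 0" "g' t\<^sub>0"] unit_speed_onD[OF g', of t t\<^sub>0]
    by (simp add: dist_commute)
  from u[OF this] v[OF this] have "?u (g' t) \<le> - t + 2 * e" "?v (g' t) \<le> t + 2 * e"
    using k k' unfolding line' by linarith+
  then have "cosh (dist (g' t) (g t)) \<le> exp (2 * (2 * e))" by (rule near_line[OF g])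
  then show ?thesis by simp
qed

lemma max_busemann_inject:
  fixes g g' :: "real \<Rightarrow> 'a"
  assumes g: "unit_speed_on UNIV g" and g': "unit_speed_on UNIV g'"
    and eq: "\<And>w. max_busemann g' w = max_busemann g w + k"
  shows "g' = g"
proof
  fix t
  have "cosh (dist (g' t) (g t)) \<le> exp (4 * 0)"
    by (rule lines_close_if_max_busemann_close[OF g g', of 0 t "\<bar>t\<bar>" k]) (simp_all add: eq)
  then have "cosh (dist (g' t) (g t)) \<le> 1" by simp
  then have "cosh (dist (g' t) (g t)) = 1" using cosh_real_ge_1 by (rule antisym)
  then show "g' t = g t" by simp
qed

text \<open>The segment from a distant point \<open>c n\<close> to \<open>z\<close> passes at distance at most \<open>\<delta>\<close> from \<open>c T\<close>, by
  \<open>fellow_travel\<close> at the vertex \<open>c n\<close>; so \<open>c T\<close> is almost on the way from \<open>z\<close> to the end of the ray.\<close>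

lemma dist_ray_le_busemann:
  fixes c :: "real \<Rightarrow> 'a"
  assumes c: "unit_speed_on {0..} c" and z: "dist z (c 0) \<le> R" and T: "R \<le> T"
    and \<delta>: "1 + exp (2 * R - 2 * T) \<le> cosh \<delta>" "0 \<le> \<delta>"
  shows "dist z (c T) - T \<le> ray_busemann c z + \<delta>"
proof (rule tendsto_lowerbound)
  show "((\<lambda>n. dist z (c n) - n + \<delta>) \<longlongrightarrow> ray_busemann c z + \<delta>) at_top"
    by (intro tendsto_add tendsto_const tendsto_ray_busemann[OF c])
  have T0: "0 \<le> T" using z T zero_le_dist[of z "c 0"] by linarith
  show "\<forall>\<^sub>F n in at_top. dist z (c T) - T \<le> dist z (c n) - n + \<delta>"
    using eventually_ge_at_top[of T]
  proof eventually_elim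
    case (elim n)
    define b where "b = dist (c n) z"
    obtain \<sigma> where \<sigma>: "unit_speed_on {0..b} \<sigma>" "\<sigma> 0 = c n" "\<sigma> b = z"
      unfolding b_def by (rule segment_exists)
    have b: "n - R \<le> b"
      using dist_triangle[of "c n" "c 0" z] unit_speed_onD[OF c, of n 0] z T0 elim by (simp add: b_def)
    have "cosh (dist (c (n - (n - T))) (\<sigma> (n - T))) \<le>
        1 + exp (2 * (n - T) - n - b + dist (c (n - n)) (\<sigma> b))"
      by (rule fellow_travel[OF unit_speed_on_reflect[OF c] \<sigma>(1), of n n])
        (use T0 elim b T \<sigma> in auto)
    also have "\<dots> \<le> 1 + exp (2 * R - 2 * T)"
      using z b by (simp add: \<sigma> dist_commute)
    finally have "cosh (dist (c T) (\<sigma> (n - T))) \<le> cosh \<delta>" using \<delta>(1) by simp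
    then have "dist (c T) (\<sigma> (n - T)) \<le> \<delta>" using \<delta>(2) by (simp add: cosh_real_nonneg_le_iff)
    moreover have "dist z (\<sigma> (n - T)) = b - (n - T)"
      using unit_speed_onD[OF \<sigma>(1), of b "n - T"] \<sigma> elim b T zero_le_dist[of "c n" z]
      by (simp add: b_def)
    ultimately show ?case
      using dist_triangle[of z "c T" "\<sigma> (n - T)"] by (simp add: b_def dist_commute)
  qed
qed simp

text \<open>The number \<open>T\<close> does not depend on the ray. This uniformity is what makes the Busemann functions
  depend continuously on the ray.\<close>

lemma ray_busemann_uniform:
  assumes "0 < \<epsilon>"
  obtains T where "0 \<le> T" "\<And>c t z. unit_speed_on {0..} c \<Longrightarrow> dist z (c 0) \<le> R \<Longrightarrow> T \<le> t \<Longrightarrow>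
    \<bar>dist (z::'a) (c t) - t - ray_busemann c z\<bar> \<le> \<epsilon>"
proof -
  have "((\<lambda>T. 1 + exp (2 * R - 2 * T)) \<longlongrightarrow> 1) at_top" by real_asymp
  moreover have "1 < cosh \<epsilon>" using assms cosh_real_nonneg_less_iff[of 0 \<epsilon>] by simp
  ultimately have "\<forall>\<^sub>F T in at_top. 1 + exp (2 * R - 2 * T) < cosh \<epsilon>" by (rule order_tendstoD)
  then obtain T where T: "\<And>t. T \<le> t \<Longrightarrow> 1 + exp (2 * R - 2 * t) < cosh \<epsilon>"
    unfolding eventually_at_top_linorder by blast
  show ?thesis
  proof (rule that[of "max T (max 0 R)"])
    fix c :: "real \<Rightarrow> 'a" and t z
    assume *: "unit_speed_on {0..} c" "dist z (c 0) \<le> R" "max T (max 0 R) \<le> t"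
    then have "dist z (c t) - t \<le> ray_busemann c z + \<epsilon>"
      using T[of t] assms by (intro dist_ray_le_busemann[of c z R t]) auto
    moreover have "ray_busemann c z \<le> dist z (c t) - t" using * by (intro ray_busemann_le) auto
    ultimately show "\<bar>dist z (c t) - t - ray_busemann c z\<bar> \<le> \<epsilon>" by simp
  qed simp
qed

lemma max_busemann_close_if_lines_close:
  assumes \<epsilon>: "0 < \<epsilon>"
  obtains T \<delta> where "0 \<le> T" "0 < \<delta>"
    "\<And>g g' z z'. unit_speed_on UNIV g \<Longrightarrow> unit_speed_on UNIV g' \<Longrightarrow>
      (\<And>t. t \<in> {- T, 0, T} \<Longrightarrow> dist (g' t) (g t) < \<delta>) \<Longrightarrow>
      dist z (g 0) \<le> R \<Longrightarrow> dist z' (g 0) \<le> R \<Longrightarrow>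
      \<bar>max_busemann g' (z::'a, z') - max_busemann g (z, z')\<bar> \<le> \<epsilon>"
proof -
  \<comment> \<open>Three errors of size \<open>\<delta>\<close> occur: the approximations for both rays and the distance of their points
    at \<open>T\<close>. The bound \<open>1\<close> keeps \<open>z\<close> within \<open>R + 1\<close> of the origin of the second ray.\<close>
  define \<delta> where "\<delta> = min 1 (\<epsilon> / 4)"
  have \<delta>: "0 < \<delta>" "\<delta> \<le> 1" "\<delta> \<le> \<epsilon> / 4" using \<epsilon> by (auto simp: \<delta>_def)
  obtain T where T: "0 \<le> T" "\<And>c t z. unit_speed_on {0..} c \<Longrightarrow> dist z (c 0) \<le> R + 1 \<Longrightarrow> T \<le> t \<Longrightarrow>
    \<bar>dist (z::'a) (c t) - t - ray_busemann c z\<bar> \<le> \<delta>"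
    using ray_busemann_uniform[OF \<delta>(1), of "R + 1"] by blast
  have ray: "\<bar>ray_busemann c' z - ray_busemann c z\<bar> \<le> \<epsilon>"
    if c: "unit_speed_on {0..} c" "unit_speed_on {0..} c'" "dist (c' 0) (c 0) < \<delta>"
      "dist (c' T) (c T) < \<delta>" "dist z (c 0) \<le> R" for c c' and z :: 'a
  proof -
    have "dist z (c' 0) \<le> R + 1"
      using dist_triangle[of z "c' 0" "c 0"] c \<delta> by (simp add: dist_commute)
    then have "\<bar>dist z (c' T) - T - ray_busemann c' z\<bar> \<le> \<delta>" using c by (intro T(2)) auto
    moreover have "\<bar>dist z (c T) - T - ray_busemann c z\<bar> \<le> \<delta>" using c by (intro T(2)) auto
    moreover have "\<bar>dist z (c' T) - dist z (c T)\<bar> \<le> \<delta>"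
      using abs_dist_diff_le[of "c' T" z "c T"] c(4) by (simp add: dist_commute)
    ultimately show ?thesis using \<delta>(3) by linarith
  qed
  show ?thesis
  proof (rule that[OF T(1) \<delta>(1)])
    fix g g' :: "real \<Rightarrow> 'a" and z z'
    assume g: "unit_speed_on UNIV g" "unit_speed_on UNIV g'"
      and near: "\<And>t. t \<in> {- T, 0, T} \<Longrightarrow> dist (g' t) (g t) < \<delta>"
      and z: "dist z (g 0) \<le> R" "dist z' (g 0) \<le> R"
    show "\<bar>max_busemann g' (z, z') - max_busemann g (z, z')\<bar> \<le> \<epsilon>"
      unfolding max_busemann_def fst_conv snd_conv
      by (intro abs_max_diff_le ray line_imp_ray reverse_line g) (use near z in auto)
  qed
qed

end

section \<open>Convergence on compact sets modulo constants\<close>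

lemma openin_uniform_neighbourhood:
  fixes f :: "'b::topological_space \<Rightarrow> 'c::metric_space"
  assumes f: "continuous_on UNIV f" and K: "compact K"
  shows "openin compact_convergence {h. continuous_on UNIV h \<and> (\<forall>x\<in>K. dist (h x) (f x) < e)}" (is "openin _ ?U")
  unfolding openin_compact_convergence
proof (intro conjI ballI)
  fix h assume h: "h \<in> ?U"
  show "\<exists>L \<epsilon>. compact L \<and> \<epsilon> > 0 \<and> {k. continuous_on UNIV k \<and> (\<forall>x\<in>L. dist (k x) (h x) < \<epsilon>)} \<subseteq> ?U"
  proof (cases "K = {}")
    case True
    then show ?thesis by (intro exI[of _ "{}"] exI[of _ "1::real"]) auto
  next
    case False
    have "continuous_on K (\<lambda>x. dist (h x) (f x))"
      using h f by (intro continuous_on_dist) (auto intro: continuous_on_subset)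
    then obtain y where y: "y \<in> K" "\<And>x. x \<in> K \<Longrightarrow> dist (h x) (f x) \<le> dist (h y) (f y)"
      using continuous_attains_sup[OF K False] by blast
    define \<epsilon> where "\<epsilon> = e - dist (h y) (f y)"
    have "0 < \<epsilon>" using h y(1) by (simp add: \<epsilon>_def)
    moreover have "dist (k x) (f x) < e" if "x \<in> K" "dist (k x) (h x) < \<epsilon>" for k x
      using y(2)[OF that(1)] that(2) dist_triangle[of "k x" "f x" "h x"] by (simp add: \<epsilon>_def)
    ultimately show ?thesis using K by blast
  qed
qed blast

lemma topspace_C_star [simp]: "topspace C_star = mod_constants ` {h. continuous_on UNIV h}"
  by (simp add: C_star_def)

text \<open>These sets are a neighbourhood base of \<open>mod_constants h\<close> in \<open>C_star\<close>. The unknown constant \<open>a\<close>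
  avoids the choice of a base point at which representatives would be normalised.\<close>

definition C_star_ball :: "('b::topological_space \<Rightarrow> real) \<Rightarrow> 'b set \<Rightarrow> real \<Rightarrow> ('b \<Rightarrow> real) set set" where
  "C_star_ball h K e = {mod_constants k | k. continuous_on UNIV k \<and> (\<exists>a. \<forall>x\<in>K. \<bar>k x - h x - a\<bar> < e)}"

lemma mod_constants_in_C_star_ball_iff:
  assumes "continuous_on UNIV k"
  shows "mod_constants k \<in> C_star_ball h K e \<longleftrightarrow> (\<exists>a. \<forall>x\<in>K. \<bar>k x - h x - a\<bar> < e)"
proof
  assume "mod_constants k \<in> C_star_ball h K e"
  then obtain k' a where *: "mod_constants k = mod_constants k'" "\<forall>x\<in>K. \<bar>k' x - h x - a\<bar> < e"
    unfolding C_star_ball_def by blast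
  then obtain b where "\<forall>w. k' w = k w + b" unfolding mod_constants_eq_iff by blast
  with * have "\<forall>x\<in>K. \<bar>k x - h x - (a - b)\<bar> < e" by (simp add: algebra_simps)
  then show "\<exists>a. \<forall>x\<in>K. \<bar>k x - h x - a\<bar> < e" by blast
qed (use assms in \<open>auto simp: C_star_ball_def\<close>)

lemma openin_C_star_ball:
  assumes h: "continuous_on UNIV h" and K: "compact K"
  shows "openin C_star (C_star_ball h K e)"
  unfolding C_star_def openin_quotient_topology
proof
  show "C_star_ball h K e \<subseteq> mod_constants ` topspace compact_convergence"
    by (auto simp: C_star_ball_def)
  have "{k \<in> topspace compact_convergence. mod_constants k \<in> C_star_ball h K e} =
    (\<Union>a. {k. continuous_on UNIV k \<and> (\<forall>x\<in>K. dist (k x) (h x + a) < e)})"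
    by (simp add: mod_constants_in_C_star_ball_iff dist_real_def diff_diff_eq set_eq_iff cong: conj_cong)
  also have "openin compact_convergence \<dots>"
    by (intro openin_Union ballI) (use h K in \<open>auto intro!: openin_uniform_neighbourhood continuous_intros\<close>)
  finally show "openin compact_convergence {k \<in> topspace compact_convergence. mod_constants k \<in> C_star_ball h K e}" .
qed

lemma C_star_ball_subset:
  assumes U: "openin C_star U" "mod_constants h \<in> U" and h: "continuous_on UNIV h"
  obtains K e where "compact K" "0 < e" "C_star_ball h K e \<subseteq> U"
proof -
  have "openin compact_convergence {x \<in> topspace compact_convergence. mod_constants x \<in> U}"
    using U(1) unfolding C_star_def openin_quotient_topology by blast
  then obtain K e where K: "compact K" "0 < e"
    "{k. continuous_on UNIV k \<and> (\<forall>x\<in>K. dist (k x) (h x) < e)} \<subseteq> {x \<in> topspace compact_convergence. mod_constants x \<in> U}"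
    using U(2) h unfolding openin_compact_convergence by auto
  have "C_star_ball h K e \<subseteq> U"
  proof
    fix A assume "A \<in> C_star_ball h K e"
    then obtain k a where k: "A = mod_constants k" "continuous_on UNIV k" "\<forall>x\<in>K. \<bar>k x - h x - a\<bar> < e"
      unfolding C_star_ball_def by blast
    then have "(\<lambda>x. k x - a) \<in> {k. continuous_on UNIV k \<and> (\<forall>x\<in>K. dist (k x) (h x) < e)}"
      by (auto intro!: continuous_intros simp: dist_real_def algebra_simps)
    then have "mod_constants (\<lambda>x. k x - a) \<in> U" using K(3) by blast
    moreover have "mod_constants (\<lambda>x. k x - a) = A"
      unfolding k(1) mod_constants_eq_iff by (intro exI[of _ a]) simp
    ultimately show "A \<in> U" by simp
  qed
  with K that show thesis by blast
qed

lemma Hausdorff_C_star: "Hausdorff_space C_star"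
  unfolding Hausdorff_space_def
proof (intro allI impI, elim conjE)
  fix A B :: "('b::topological_space \<Rightarrow> real) set"
  assume "A \<in> topspace C_star" "B \<in> topspace C_star" "A \<noteq> B"
  then obtain h k where h: "A = mod_constants h" "continuous_on UNIV h"
    and k: "B = mod_constants k" "continuous_on UNIV k" by auto
  obtain x y where xy: "k x - h x \<noteq> k y - h y"
  proof (rule ccontr)
    assume "\<not> thesis"
    then have "k x - h x = k y - h y" for x y using that by blast
    then have "k w = h w + (k x - h x)" for w x by (simp add: algebra_simps)
    then have "A = B" unfolding h k mod_constants_eq_iff by blast
    with \<open>A \<noteq> B\<close> show False ..
  qed
  define e where "e = \<bar>(k x - h x) - (k y - h y)\<bar> / 4"
  define U V where "U = C_star_ball h {x, y} e" and "V = C_star_ball k {x, y} e"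
  have "openin C_star U" "openin C_star V"
    unfolding U_def V_def using h k by (auto intro!: openin_C_star_ball)
  moreover have "A \<in> U" "B \<in> V"
    unfolding U_def V_def h(1) k(1) mod_constants_in_C_star_ball_iff[OF h(2)] mod_constants_in_C_star_ball_iff[OF k(2)]
    using xy by (auto simp: e_def intro!: exI[of _ 0])
  moreover have "disjnt U V"
    unfolding disjnt_iff
  proof (intro allI notI, elim conjE)
    fix C assume "C \<in> U" "C \<in> V"
    then obtain l where l: "C = mod_constants l" "continuous_on UNIV l" by (auto simp: U_def C_star_ball_def)
    obtain a b where "\<bar>l x - h x - a\<bar> < e" "\<bar>l y - h y - a\<bar> < e" "\<bar>l x - k x - b\<bar> < e" "\<bar>l y - k y - b\<bar> < e"
      using \<open>C \<in> U\<close> \<open>C \<in> V\<close> unfolding U_def V_def l(1) mod_constants_in_C_star_ball_iff[OF l(2)] by auto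
    then have "(k x - h x) - (k y - h y) < 4 * e" "- ((k x - h x) - (k y - h y)) < 4 * e" by linarith+
    then have "\<bar>(k x - h x) - (k y - h y)\<bar> < 4 * e" by (simp only: abs_less_iff)
    then show False by (simp add: e_def)
  qed
  ultimately show "\<exists>U V. openin C_star U \<and> openin C_star V \<and> A \<in> U \<and> B \<in> V \<and> disjnt U V" by blast
qed

lemma continuous_on_d_max: "continuous_on UNIV (d_max v)"
  unfolding d_max_def by (intro continuous_intros)

lemma continuous_on_max_busemann:
  assumes g: "unit_speed_on UNIV g"
  shows "continuous_on UNIV (max_busemann g)"
proof -
  have "continuous_on UNIV (ray_busemann c)" if c: "unit_speed_on {0..} c" for c :: "real \<Rightarrow> 'a::metric_space"
  proof (rule lipschitz_on_continuous_on[of 1], rule lipschitz_onI)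
    show "dist (ray_busemann c z) (ray_busemann c w) \<le> 1 * dist z w" for z w
      using ray_busemann_lipschitz[OF c, of z w] ray_busemann_lipschitz[OF c, of w z]
      by (simp add: dist_real_def dist_commute abs_le_iff)
  qed simp
  then have *: "continuous_on UNIV (ray_busemann g)" "continuous_on UNIV (ray_busemann (reverse g))"
    using g by (simp_all add: line_imp_ray reverse_line)
  show ?thesis
    unfolding max_busemann_def[abs_def]
  proof (rule continuous_on_max)
    show "continuous_on UNIV (\<lambda>w. ray_busemann g (fst w))"
      by (rule continuous_on_compose2[OF *(1)]) (auto intro: continuous_intros)
    show "continuous_on UNIV (\<lambda>w. ray_busemann (reverse g) (snd w))"
      by (rule continuous_on_compose2[OF *(2)]) (auto intro: continuous_intros)
  qed
qed

lemma continuous_on_line: "unit_speed_on UNIV g \<Longrightarrow> continuous_on UNIV g"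
  by (rule lipschitz_on_continuous_on[of 1], rule lipschitz_onI) (simp_all add: unit_speed_onD dist_real_def)

lemma compact_pairs_bounded:
  fixes x :: "'a::metric_space"
  assumes "compact K"
  obtains R where "\<And>z z'. (z, z') \<in> K \<Longrightarrow> dist z x \<le> R" "\<And>z z'. (z, z') \<in> K \<Longrightarrow> dist z' x \<le> R"
proof -
  have "bounded (fst ` K)" "bounded (snd ` K)"
    using assms by (auto intro!: compact_imp_bounded compact_continuous_image continuous_intros)
  then obtain R R' where "\<forall>z\<in>fst ` K. dist x z \<le> R" "\<forall>z\<in>snd ` K. dist x z \<le> R'"
    unfolding bounded_any_center[of _ x] by blast
  then show thesis by (intro that[of "max R R'"]) (force simp: dist_commute)+
qed

context proper_CAT_minus_one
begin

text \<open>The constant by which \<open>d_max (g n, g (- n))\<close> is corrected is \<open>n\<close>, for both coordinates at once; so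
  the maximum converges to the maximum of the Busemann functions. The convergence is uniform on
  bounded sets by \<open>ray_busemann_uniform\<close>.\<close>

lemma limitin_max_embedding:
  fixes g :: "real \<Rightarrow> 'a"
  assumes g: "unit_speed_on UNIV g"
  shows "limitin max_compactification (\<lambda>n. max_embedding (g (real n), g (- real n)))
    (mod_constants (max_busemann g)) sequentially"
proof -
  let ?x = "\<lambda>n. max_embedding (g (real n), g (- real n))" and ?l = "mod_constants (max_busemann g)"
  have ev: "\<forall>\<^sub>F n in sequentially. ?x n \<in> U" if U: "openin C_star U" "?l \<in> U" for U
  proof -
    obtain K e where K: "compact K" "0 < e" "C_star_ball (max_busemann g) K e \<subseteq> U"
      using C_star_ball_subset[OF U continuous_on_max_busemann[OF g]] by blast
    obtain R where R: "\<And>z z'. (z, z') \<in> K \<Longrightarrow> dist z (g 0) \<le> R" "\<And>z z'. (z, z') \<in> K \<Longrightarrow> dist z' (g 0) \<le> R"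
      using compact_pairs_bounded[OF K(1)] by blast
    obtain T where T: "0 \<le> T" "\<And>c t z. unit_speed_on {0..} c \<Longrightarrow> dist z (c 0) \<le> R \<Longrightarrow> T \<le> t \<Longrightarrow>
        \<bar>dist (z::'a) (c t) - t - ray_busemann c z\<bar> \<le> e / 2"
      using ray_busemann_uniform[of "e / 2" R] K(2) by auto
    have x: "?x n \<in> C_star_ball (max_busemann g) K e" if n: "T \<le> real n" for n
    proof -
      have "\<bar>d_max (g (real n), g (- real n)) w - max_busemann g w - real n\<bar> < e" if "w \<in> K" for w
      proof -
        obtain z z' where w: "w = (z, z')" by (cases w)
        have "\<bar>dist z (g (real n)) - real n - ray_busemann g z\<bar> \<le> e / 2"
          using R(1) that w n by (intro T(2) line_imp_ray g) auto
        moreover have "\<bar>dist z' (reverse g (real n)) - real n - ray_busemann (reverse g) z'\<bar> \<le> e / 2"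
          using R(2) that w n by (intro T(2) line_imp_ray reverse_line g) auto
        ultimately show ?thesis
          using K(2) unfolding w d_max_def max_busemann_def fst_conv snd_conv dist_commute[of _ z] dist_commute[of _ z']
          by linarith
      qed
      then show ?thesis
        unfolding max_embedding_def mod_constants_in_C_star_ball_iff[OF continuous_on_d_max] by blast
    qed
    have "\<forall>\<^sub>F n in sequentially. T \<le> real n"
      using filterlim_real_sequentially by (simp add: filterlim_at_top)
    then show ?thesis by (rule eventually_mono) (use x K(3) in blast)
  qed
  have l: "?l \<in> topspace C_star" using continuous_on_max_busemann[OF g] by simp
  have "?l \<in> C_star closure_of range max_embedding"
    unfolding in_closure_of
  proof (intro conjI l allI impI, elim conjE)
    fix U assume "?l \<in> U" "openin C_star U"
    then obtain n where "?x n \<in> U" using eventually_happens[OF ev] by auto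
    then show "\<exists>y. y \<in> range max_embedding \<and> y \<in> U" by blast
  qed
  moreover have "range max_embedding \<subseteq> topspace (C_star :: ('a \<times> 'a \<Rightarrow> real) set topology)"
    using continuous_on_d_max by (auto simp: max_embedding_def)
  then have "?x n \<in> C_star closure_of range max_embedding" for n
    using closure_of_subset[of "range max_embedding" "C_star :: ('a \<times> 'a \<Rightarrow> real) set topology"] by blast
  ultimately show ?thesis
    unfolding max_compactification_def limitin_subtopology limitin_def[of C_star] using l ev by simp
qed

lemma limitin_max_embedding_unique:
  fixes g :: "real \<Rightarrow> 'a"
  assumes g: "unit_speed_on UNIV g"
    and "limitin max_compactification (\<lambda>n. max_embedding (g (real n), g (- real n))) l sequentially"
  shows "l = mod_constants (max_busemann g)"
  by (rule limitin_Hausdorff_unique[OF assms(2) limitin_max_embedding[OF g]])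
    (auto simp: max_compactification_def intro: Hausdorff_space_subtopology Hausdorff_C_star)

lemma endpoint_map_eq:
  fixes g :: "real \<Rightarrow> 'a"
  assumes g: "unit_speed_on UNIV g"
  shows "endpoint_map g = mod_constants (max_busemann g)"
  unfolding endpoint_map_def
  using limitin_max_embedding[OF g] limitin_max_embedding_unique[OF g] by (rule the_equality)

end

section \<open>Geodesic lines and the set of pairs of distinct boundary points\<close>

lemma rays_iff: "c \<in> rays \<longleftrightarrow> c \<in> extensional {0..} \<and> unit_speed_on {0..} c"
  by (auto simp: rays_def unit_speed_on_def)

lemma geodesics_iff: "g \<in> geodesics \<longleftrightarrow> unit_speed_on UNIV g"
  by (simp add: geodesics_def unit_speed_on_def)

lemma restrict_in_rays: "unit_speed_on {0..} c \<Longrightarrow> restrict c {0..} \<in> rays"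
  by (simp add: rays_iff unit_speed_on_def)

lemma busemann_eq: "busemann p \<xi> = ray_busemann (ray_from p \<xi>)"
  by (simp add: fun_eq_iff busemann_def ray_busemann_def)

lemma ideal_boundaryE:
  assumes "\<xi> \<in> ideal_boundary"
  obtains c where "c \<in> rays" "\<xi> = asymptotic `` {c}"
  using assms unfolding ideal_boundary_def by (rule quotientE)

lemma asymptotic_if_same_class:
  "\<xi> \<in> ideal_boundary \<Longrightarrow> c \<in> \<xi> \<Longrightarrow> c' \<in> \<xi> \<Longrightarrow> (c, c') \<in> asymptotic"
  using quotient_eq_iff[OF equiv_asymptotic] unfolding ideal_boundary_def by blast

context proper_CAT_minus_one
begin

lemma same_class_same_origin_eq:
  fixes c c' :: "real \<Rightarrow> 'a"
  assumes "\<xi> \<in> ideal_boundary" "c \<in> \<xi>" "c' \<in> \<xi>" "c 0 = c' 0"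
  shows "c = c'"
proof -
  have "(c, c') \<in> asymptotic" using assms by (intro asymptotic_if_same_class)
  then obtain B where *: "c \<in> rays" "c' \<in> rays" "\<And>t. 0 \<le> t \<Longrightarrow> dist (c t) (c' t) \<le> B"
    unfolding asymptotic_def by auto
  then have "c t = c' t" if "0 \<le> t" for t
    using asymptotic_rays_eq[of c c' B t] assms(4) that by (auto simp: rays_iff)
  then show ?thesis using * by (intro extensionalityI[of c "{0..}"]) (auto simp: rays_iff)
qed

lemma ray_from:
  fixes p :: 'a
  assumes \<xi>: "\<xi> \<in> ideal_boundary"
  shows "ray_from p \<xi> \<in> \<xi>" "ray_from p \<xi> 0 = p" "unit_speed_on {0..} (ray_from p \<xi>)"
proof -
  obtain c where c: "c \<in> rays" "\<xi> = asymptotic `` {c}" using \<xi> by (rule ideal_boundaryE)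
  then have "unit_speed_on {0..} c" by (simp add: rays_iff)
  then obtain c' B where c': "unit_speed_on {0..} c'" "c' 0 = p" "\<And>t. 0 \<le> t \<Longrightarrow> dist (c' t) (c t) \<le> B"
    using asymptotic_ray_exists[where c = c and p = p] by metis
  have "(c, restrict c' {0..}) \<in> asymptotic"
    using c(1) restrict_in_rays[OF c'(1)] c'(3) by (auto simp: asymptotic_def dist_commute)
  then have r: "restrict c' {0..} \<in> \<xi> \<and> restrict c' {0..} 0 = p" using c c' by simp
  have "ray_from p \<xi> \<in> \<xi> \<and> ray_from p \<xi> 0 = p"
    unfolding ray_from_def
    by (rule theI[where P = "\<lambda>c. c \<in> \<xi> \<and> c 0 = p" and a = "restrict c' {0..}", OF r]) (use r same_class_same_origin_eq[OF \<xi>] in metis)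
  then show *: "ray_from p \<xi> \<in> \<xi>" "ray_from p \<xi> 0 = p" by auto
  show "unit_speed_on {0..} (ray_from p \<xi>)"
    using asymptotic_if_same_class[OF \<xi> *(1) *(1)] by (auto simp: asymptotic_def rays_iff)
qed

lemma busemann_class_of_ray:
  fixes c :: "real \<Rightarrow> 'a"
  assumes c: "unit_speed_on {0..} c"
  shows "asymptotic `` {restrict c {0..}} \<in> ideal_boundary"
    and "busemann (c 0) (asymptotic `` {restrict c {0..}}) = ray_busemann c"
proof -
  let ?c = "restrict c {0..}"
  let ?\<xi> = "asymptotic `` {?c}"
  show \<xi>: "?\<xi> \<in> ideal_boundary"
    unfolding ideal_boundary_def using restrict_in_rays[OF c] by (rule quotientI)
  have "?c \<in> ?\<xi>" using restrict_in_rays[OF c] by (auto simp: asymptotic_def)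
  then have "ray_from (c 0) ?\<xi> = ?c"
    using ray_from[OF \<xi>, of "c 0"] by (intro same_class_same_origin_eq[OF \<xi>]) auto
  then show "busemann (c 0) ?\<xi> = ray_busemann c"
    unfolding busemann_eq by (intro ext) (simp, rule ray_busemann_cong, simp)
qed

lemma mod_constants_max_busemann_in_Omega:
  fixes g :: "real \<Rightarrow> 'a"
  assumes g: "unit_speed_on UNIV g"
  shows "mod_constants (max_busemann g) \<in> Omega"
proof -
  define \<xi> \<xi>' where "\<xi> = asymptotic `` {restrict g {0..}}" and "\<xi>' = asymptotic `` {restrict (reverse g) {0..}}"
  have 1: "\<xi> \<in> ideal_boundary" "busemann (g 0) \<xi> = ray_busemann g"
    unfolding \<xi>_def by (fact busemann_class_of_ray[OF line_imp_ray[OF g]])+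
  have 2: "\<xi>' \<in> ideal_boundary" "busemann (g 0) \<xi>' = ray_busemann (reverse g)"
    unfolding \<xi>'_def using busemann_class_of_ray[OF line_imp_ray[OF reverse_line[OF g]]] by auto
  have "\<xi> \<noteq> \<xi>'"
  proof
    assume "\<xi> = \<xi>'"
    moreover have "restrict g {0..} \<in> \<xi>" "restrict (reverse g) {0..} \<in> \<xi>'"
      using restrict_in_rays[OF line_imp_ray[OF g]] restrict_in_rays[OF line_imp_ray[OF reverse_line[OF g]]]
      by (auto simp: \<xi>_def \<xi>'_def asymptotic_def)
    ultimately have "(restrict g {0..}, restrict (reverse g) {0..}) \<in> asymptotic"
      using asymptotic_if_same_class[OF 1(1)] by blast
    then obtain B where B: "\<And>t. 0 \<le> t \<Longrightarrow> dist (g t) (g (- t)) \<le> B" by (auto simp: asymptotic_def)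
    from B[of "\<bar>B\<bar> + 1"] show False by (simp add: unit_speed_onD[OF g])
  qed
  moreover have "max_busemann g = (\<lambda>(z, z'). max (busemann (g 0) \<xi> z) (busemann (g 0) \<xi>' z'))"
    by (simp add: 1 2 fun_eq_iff max_busemann_def)
  ultimately show ?thesis
    unfolding Omega_def mem_Collect_eq using 1(1) 2(1)
    by (intro exI[where x = "g 0"] exI[where x = \<xi>] exI[where x = \<xi>'] conjI) simp_all
qed

text \<open>A line \<open>g\<close> with the given ends represents the class up to constants \<open>a\<close> and \<open>b\<close>, which come from the
  base points \<open>p\<close> and \<open>p'\<close>. Shifting its parameter by \<open>s\<close> changes them in opposite directions, and
  \<open>s = (b - a) / 2\<close> makes them equal to \<open>(a + b) / 2\<close>.\<close>

lemma Omega_obtain_line: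
  assumes "A \<in> (Omega :: ('a \<times> 'a \<Rightarrow> real) set set)"
  obtains g where "unit_speed_on UNIV g" "A = mod_constants (max_busemann g)"
proof -
  obtain p p' :: 'a and \<xi> \<xi>' where A: "A = mod_constants (\<lambda>(z, z'). max (busemann p \<xi> z) (busemann p' \<xi>' z'))"
    and \<xi>: "\<xi> \<in> ideal_boundary" "\<xi>' \<in> ideal_boundary" "\<xi> \<noteq> \<xi>'"
    using assms unfolding Omega_def by blast
  define c c' where "c = ray_from p \<xi>" and "c' = ray_from p \<xi>'"
  note c = ray_from[OF \<xi>(1), of p, folded c_def] and c' = ray_from[OF \<xi>(2), of p, folded c'_def]
  have rays: "c \<in> rays" "c' \<in> rays"
    using asymptotic_if_same_class[OF \<xi>(1) c(1) c(1)] asymptotic_if_same_class[OF \<xi>(2) c'(1) c'(1)]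
    by (auto simp: asymptotic_def)
  have "\<exists>r\<ge>0. c r \<noteq> c' r"
  proof (rule ccontr)
    assume "\<not> ?thesis"
    then have "(c, c') \<in> asymptotic" using rays by (auto simp: asymptotic_def)
    then have "\<xi> = \<xi>'"
      using quotient_eq_iff[OF equiv_asymptotic, of \<xi> \<xi>' c c'] \<xi> c(1) c'(1) by (simp add: ideal_boundary_def)
    with \<xi>(3) show False ..
  qed
  then obtain r where r: "0 \<le> r" "c r \<noteq> c' r" by blast
  obtain g B where g: "unit_speed_on UNIV g"
    and B: "\<And>t. 0 \<le> t \<Longrightarrow> dist (g t) (c t) \<le> B" "\<And>t. 0 \<le> t \<Longrightarrow> dist (g (- t)) (c' t) \<le> B"
    using line_between_rays[OF c(3) c'(3) _ r] c(2) c'(2) by auto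
  define a where "a = ray_busemann g p"
  have \<beta>: "busemann p \<xi> z = ray_busemann g z - a" for z
    using ray_busemann_asymptotic[OF line_imp_ray[OF g] c(3) B(1), of z] c(2)
    by (simp add: busemann_eq c_def[symmetric] a_def)
  define b where "b = ray_busemann (reverse g) p'"
  note d = ray_from[OF \<xi>(2), of p']
  obtain B' where B': "\<And>t. 0 \<le> t \<Longrightarrow> dist (c' t) (ray_from p' \<xi>' t) \<le> B'"
    using asymptotic_if_same_class[OF \<xi>(2) c'(1) d(1)] by (auto simp: asymptotic_def)
  have \<beta>': "busemann p' \<xi>' z = ray_busemann (reverse g) z - b" for z
  proof -
    have "dist (g (- t)) (ray_from p' \<xi>' t) \<le> B + B'" if "0 \<le> t" for t
      using B(2)[OF that] B'[OF that] dist_triangle[of "g (- t)" "ray_from p' \<xi>' t" "c' t"] by simp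
    then show ?thesis
      using ray_busemann_asymptotic[OF line_imp_ray[OF reverse_line[OF g]] d(3), of "B + B'" z] d(2)
      by (simp add: busemann_eq b_def)
  qed
  define s where "s = (b - a) / 2"
  define h where "h = (\<lambda>t. g (s + t))"
  have h: "unit_speed_on UNIV h" unfolding h_def by (rule unit_speed_on_shift[OF g]) simp
  have hu: "ray_busemann h z = ray_busemann g z + s" for z
    unfolding h_def by (rule ray_busemann_shift[OF line_imp_ray[OF g]])
  have hv: "ray_busemann (reverse h) z = ray_busemann (reverse g) z - s" for z
    using ray_busemann_shift[OF line_imp_ray[OF reverse_line[OF g]], of "- s" z] by (simp add: h_def)
  define m where "m = - (a + b) / 2"
  have "r - a = (r + s) + m" "r - b = (r - s) + m" for r by (simp_all add: s_def m_def field_simps)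
  then have "max (busemann p \<xi> z) (busemann p' \<xi>' z') = max_busemann h (z, z') + m" for z z'
    unfolding max_busemann_def fst_conv snd_conv \<beta> \<beta>' hu hv by (simp only: max_add_distrib_left)
  then have "\<exists>k. \<forall>w. (\<lambda>(z, z'). max (busemann p \<xi> z) (busemann p' \<xi>' z')) w = max_busemann h w + k"
    by (intro exI[of _ m]) auto
  then have "A = mod_constants (max_busemann h)"
    unfolding A by (rule mod_constants_eq_iff[THEN iffD2, symmetric])
  with h show thesis by (rule that)
qed

lemma mod_constants_max_busemann_not_in_range:
  fixes g :: "real \<Rightarrow> 'a"
  assumes g: "unit_speed_on UNIV g"
  shows "mod_constants (max_busemann g) \<notin> range max_embedding"
proof
  assume "mod_constants (max_busemann g) \<in> range max_embedding"
  then obtain v a where v: "\<And>w. d_max v w = max_busemann g w + a"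
    unfolding max_embedding_def image_iff mod_constants_eq_iff by blast
  have "d_max v (g t, g (- t)) = - t + a" for t
    using v by (simp add: max_busemann_def ray_busemann_on_line[OF g] ray_busemann_reverse_on_line[OF g])
  moreover have "0 \<le> d_max v (g t, g (- t))" for t by (simp add: d_max_def le_max_iff_disj)
  ultimately have "0 \<le> - (a + 1) + a" by metis
  then show False by simp
qed

lemma Omega_subset_max_boundary: "(Omega :: ('a \<times> 'a \<Rightarrow> real) set set) \<subseteq> max_boundary"
proof
  fix A :: "('a \<times> 'a \<Rightarrow> real) set" assume "A \<in> Omega"
  then obtain g where g: "unit_speed_on UNIV g" "A = mod_constants (max_busemann g)" by (rule Omega_obtain_line)
  then show "A \<in> max_boundary"
    using limitin_max_embedding[OF g(1)] mod_constants_max_busemann_not_in_range[OF g(1)]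
    by (simp add: max_boundary_def limitin_def)
qed

text \<open>A basic neighbourhood of the image involves a bounded set of pairs only, and there three points of the
  line control the representative by \<open>max_busemann_close_if_lines_close\<close>.\<close>

lemma continuous_map_endpoint_map:
  "continuous_map (subtopology compact_convergence (geodesics :: (real \<Rightarrow> 'a) set)) C_star endpoint_map"
  (is "continuous_map ?G _ _")
proof -
  note cont = continuous_on_line
  have top: "topspace ?G = geodesics" using cont by (auto simp: geodesics_iff)
  show ?thesis
    unfolding continuous_map_def
  proof (intro conjI allI impI)
    show "endpoint_map \<in> topspace ?G \<rightarrow> topspace C_star"
      unfolding top by (auto simp: geodesics_iff endpoint_map_eq continuous_on_max_busemann)
    fix U assume U: "openin (C_star :: ('a \<times> 'a \<Rightarrow> real) set topology) U"
    show "openin ?G {g \<in> topspace ?G. endpoint_map g \<in> U}"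
    proof (subst openin_subopen, intro ballI)
      fix g assume "g \<in> {g \<in> topspace ?G. endpoint_map g \<in> U}"
      then have g: "unit_speed_on UNIV g" "mod_constants (max_busemann g) \<in> U"
        unfolding top by (auto simp: geodesics_iff endpoint_map_eq)
      obtain K e where K: "compact K" "0 < e" "C_star_ball (max_busemann g) K e \<subseteq> U"
        using C_star_ball_subset[OF U g(2) continuous_on_max_busemann[OF g(1)]] by blast
      obtain R where R: "\<And>z z'. (z, z') \<in> K \<Longrightarrow> dist z (g 0) \<le> R" "\<And>z z'. (z, z') \<in> K \<Longrightarrow> dist z' (g 0) \<le> R"
        using compact_pairs_bounded[OF K(1)] by blast
      obtain T \<delta> where T: "0 \<le> T" "0 < \<delta>"
        "\<And>g g' z z'. unit_speed_on UNIV g \<Longrightarrow> unit_speed_on UNIV g' \<Longrightarrow>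
          (\<And>t. t \<in> {- T, 0, T} \<Longrightarrow> dist (g' t) (g t) < \<delta>) \<Longrightarrow>
          dist z (g 0) \<le> R \<Longrightarrow> dist z' (g 0) \<le> R \<Longrightarrow>
          \<bar>max_busemann g' (z::'a, z') - max_busemann g (z, z')\<bar> \<le> e / 2"
        using max_busemann_close_if_lines_close[of "e / 2" R] K(2) by auto
      define V where "V = {h. continuous_on UNIV h \<and> (\<forall>t\<in>{- T, 0, T}. dist (h t) (g t) < \<delta>)}"
      have "openin compact_convergence V"
        unfolding V_def by (rule openin_uniform_neighbourhood[OF cont[OF g(1)]]) simp
      then have "openin ?G (V \<inter> geodesics)" by (auto simp: openin_subtopology)
      moreover have "g \<in> V \<inter> geodesics" using T(2) g cont by (auto simp: V_def geodesics_iff)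
      moreover have "V \<inter> geodesics \<subseteq> {g \<in> topspace ?G. endpoint_map g \<in> U}"
      proof
        fix g' assume "g' \<in> V \<inter> geodesics"
        then have g': "unit_speed_on UNIV g'" "\<And>t. t \<in> {- T, 0, T} \<Longrightarrow> dist (g' t) (g t) < \<delta>"
          by (auto simp: V_def geodesics_iff)
        have "\<bar>max_busemann g' w - max_busemann g w - 0\<bar> < e" if "w \<in> K" for w
          using T(3)[OF g(1) g', of "fst w" "snd w"] R[of "fst w" "snd w"] that K(2) by simp
        then have "mod_constants (max_busemann g') \<in> U"
          using K(3) mod_constants_in_C_star_ball_iff[OF continuous_on_max_busemann[OF g'(1)]] by blast
        then show "g' \<in> {g \<in> topspace ?G. endpoint_map g \<in> U}"
          unfolding top using g' by (auto simp: geodesics_iff endpoint_map_eq)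
      qed
      ultimately show "\<exists>W. openin ?G W \<and> g \<in> W \<and> W \<subseteq> {g \<in> topspace ?G. endpoint_map g \<in> U}" by blast
    qed
  qed
qed

text \<open>The inverse is continuous by \<open>lines_close_if_max_busemann_close\<close>: agreement of the representatives on a
  ball whose radius exceeds \<open>T\<close> by a constant controls the line on \<open>{- T..T}\<close>.\<close>

lemma open_map_endpoint_map:
  "open_map (subtopology compact_convergence (geodesics :: (real \<Rightarrow> 'a) set)) (subtopology C_star Omega) endpoint_map"
  unfolding open_map_def
proof (intro allI impI)
  fix U assume "openin (subtopology compact_convergence (geodesics :: (real \<Rightarrow> 'a) set)) U"
  then obtain V where V: "openin compact_convergence V" "U = V \<inter> geodesics" by (auto simp: openin_subtopology)
  show "openin (subtopology C_star Omega) (endpoint_map ` U)"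
  proof (subst openin_subopen, intro ballI)
    fix A assume "A \<in> endpoint_map ` U"
    then obtain g where g: "g \<in> V" "unit_speed_on UNIV g" "A = mod_constants (max_busemann g)"
      unfolding V(2) by (auto simp: geodesics_iff endpoint_map_eq)
    obtain K \<epsilon> where K: "compact K" "\<epsilon> > 0" "{h. continuous_on UNIV h \<and> (\<forall>t\<in>K. dist (h t) (g t) < \<epsilon>)} \<subseteq> V"
      using V(1) g(1) unfolding openin_compact_convergence by meson
    obtain T where T: "\<And>t. t \<in> K \<Longrightarrow> \<bar>t\<bar> \<le> T"
      using compact_imp_bounded[OF K(1)] by (auto simp: bounded_iff)
    have "((\<lambda>e::real. exp (4 * e)) \<longlongrightarrow> exp (4 * 0)) (at_right 0)" by (intro tendsto_intros)
    moreover have "exp (4 * 0) < cosh \<epsilon>" using K(2) cosh_real_nonneg_less_iff[of 0 \<epsilon>] by simp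
    ultimately have "\<forall>\<^sub>F e in at_right 0. exp (4 * e) < cosh \<epsilon>" by (rule order_tendstoD)
    then have "\<forall>\<^sub>F e in at_right 0. exp (4 * e) < cosh \<epsilon> \<and> 0 < e \<and> e < (1::real)"
      using eventually_at_right_real[of 0 1] by (auto elim: eventually_elim2)
    then obtain e where e: "exp (4 * e) < cosh \<epsilon>" "0 < e" "e < 1"
      by (auto dest: eventually_happens)
    define L where "L = cball (g 0) (T + 15) \<times> cball (g 0) (T + 15)"
    define W where "W = C_star_ball (max_busemann g) L e"
    have "compact L" unfolding L_def by (intro compact_Times proper)
    then have "openin C_star W"
      unfolding W_def by (rule openin_C_star_ball[OF continuous_on_max_busemann[OF g(2)]])
    then have "openin (subtopology C_star Omega) (W \<inter> Omega)" by (auto simp: openin_subtopology)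
    moreover have "A \<in> W \<inter> Omega"
      using mod_constants_max_busemann_in_Omega[OF g(2)] e(2)
      unfolding g(3) W_def by (auto simp: mod_constants_in_C_star_ball_iff continuous_on_max_busemann g(2) intro!: exI[of _ 0])
    moreover have "W \<inter> Omega \<subseteq> endpoint_map ` U"
    proof
      fix B assume B: "B \<in> W \<inter> Omega"
      then obtain g' where g': "unit_speed_on UNIV g'" "B = mod_constants (max_busemann g')"
        using Omega_obtain_line by blast
      obtain k where k: "\<And>w. w \<in> L \<Longrightarrow> \<bar>max_busemann g' w - max_busemann g w - k\<bar> < e"
        using B unfolding g'(2) W_def by (auto simp: mod_constants_in_C_star_ball_iff continuous_on_max_busemann g'(1))
      have "dist (g' t) (g t) < \<epsilon>" if "t \<in> K" for t
      proof (rule dist_less_if_cosh_less[OF _ K(2)])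
        have "cosh (dist (g' t) (g t)) \<le> exp (4 * e)"
          using T[OF that] e k
          by (intro lines_close_if_max_busemann_close[OF g(2) g'(1), of e t T k])
            (auto simp: L_def dist_commute intro: less_imp_le)
        with e(1) show "cosh (dist (g' t) (g t)) < cosh \<epsilon>" by simp
      qed
      moreover have "continuous_on UNIV g'" by (rule continuous_on_line[OF g'(1)])
      ultimately have "g' \<in> U" using K(3) g'(1) by (auto simp: V(2) geodesics_iff)
      then show "B \<in> endpoint_map ` U" using endpoint_map_eq[OF g'(1)] g'(2) by blast
    qed
    ultimately show "\<exists>T. openin (subtopology C_star Omega) T \<and> A \<in> T \<and> T \<subseteq> endpoint_map ` U" by blast
  qed
qed

text \<open>Since \<open>\<gamma>\<close> is an isometry, the distance from \<open>z\<close> to \<open>\<gamma> (g t)\<close> is that from the preimage of \<open>z\<close> to \<open>g t\<close>,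
  and so the representative of \<open>\<gamma> \<circ> g\<close> is the composition of that of \<open>g\<close> with the inverse of \<open>\<gamma>\<close>.\<close>

lemma endpoint_map_equivariant:
  fixes g :: "real \<Rightarrow> 'a"
  assumes \<gamma>: "\<gamma> \<in> carrier isometry_group" and g: "unit_speed_on UNIV g"
  shows "endpoint_map (\<gamma> \<circ> g) = diag_action \<gamma> (endpoint_map g)"
proof -
  have iso: "dist (\<gamma> x) (\<gamma> y) = dist x y" for x y using \<gamma> by (simp add: isometry_group_def)
  have inv: "\<gamma> (inv_into UNIV \<gamma> z) = z" for z
    using bij_is_surj[OF isometry_bij[OF \<gamma>]] by (rule surj_f_inv_f)
  have \<gamma>g: "unit_speed_on UNIV (\<gamma> \<circ> g)" using g by (simp add: unit_speed_on_def iso)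
  have "dist z (\<gamma> x) = dist (inv_into UNIV \<gamma> z) x" for z x by (metis iso inv)
  then have "max_busemann (\<gamma> \<circ> g) = max_busemann g \<circ> map_prod (inv_into UNIV \<gamma>) (inv_into UNIV \<gamma>)"
    by (auto simp: fun_eq_iff max_busemann_def ray_busemann_def)
  then show ?thesis
    by (simp only: endpoint_map_eq[OF g] endpoint_map_eq[OF \<gamma>g] diag_action_mod_constants)
qed

lemma homeomorphic_map_endpoint_map:
  "homeomorphic_map (subtopology compact_convergence (geodesics :: (real \<Rightarrow> 'a) set))
     (subtopology max_compactification Omega) endpoint_map"
proof -
  let ?G = "subtopology compact_convergence (geodesics :: (real \<Rightarrow> 'a) set)"
  have sub: "(Omega :: ('a \<times> 'a \<Rightarrow> real) set set) \<subseteq> C_star closure_of range max_embedding"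
    using Omega_subset_max_boundary by (auto simp: max_boundary_def max_compactification_def)
  then have Y: "subtopology max_compactification Omega = subtopology C_star (Omega :: ('a \<times> 'a \<Rightarrow> real) set set)"
    by (simp add: max_compactification_def subtopology_subtopology inf_absorb2)
  have top: "topspace ?G \<subseteq> geodesics" by auto
  have image: "endpoint_map ` topspace ?G = (Omega :: ('a \<times> 'a \<Rightarrow> real) set set)"
  proof (intro equalityI subsetI)
    fix A assume "A \<in> endpoint_map ` topspace ?G"
    then show "A \<in> Omega"
      using top mod_constants_max_busemann_in_Omega by (auto simp: geodesics_iff endpoint_map_eq)
  next
    fix A assume "A \<in> (Omega :: ('a \<times> 'a \<Rightarrow> real) set set)"
    then obtain g where g: "unit_speed_on UNIV g" "A = mod_constants (max_busemann g)" by (rule Omega_obtain_line)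
    have "continuous_on UNIV g" by (rule continuous_on_line[OF g(1)])
    with g show "A \<in> endpoint_map ` topspace ?G"
      using endpoint_map_eq[OF g(1)] by (auto simp: geodesics_iff)
  qed
  show ?thesis
    unfolding Y
  proof (rule bijective_open_imp_homeomorphic_map)
    show "continuous_map ?G (subtopology C_star Omega) endpoint_map"
      using continuous_map_endpoint_map image by (auto simp: continuous_map_in_subtopology)
    show "open_map ?G (subtopology C_star Omega) endpoint_map" by (rule open_map_endpoint_map)
    have "(Omega :: ('a \<times> 'a \<Rightarrow> real) set set) \<subseteq> topspace C_star"
      using sub closure_of_subset_topspace by fast
    then show "endpoint_map ` topspace ?G = topspace (subtopology C_star (Omega :: ('a \<times> 'a \<Rightarrow> real) set set))"
      unfolding image by auto
    show "inj_on endpoint_map (topspace ?G)"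
    proof (rule inj_onI)
      fix g g' assume "g \<in> topspace ?G" "g' \<in> topspace ?G" and eq: "endpoint_map g = endpoint_map g'"
      then have g: "unit_speed_on UNIV g" "unit_speed_on UNIV g'" by (auto simp: geodesics_iff)
      obtain k where "\<forall>w. max_busemann g' w = max_busemann g w + k"
        using eq unfolding endpoint_map_eq[OF g(1)] endpoint_map_eq[OF g(2)] mod_constants_eq_iff by blast
      then have "g' = g" by (intro max_busemann_inject[OF g]) blast
      then show "g = g'" ..
    qed
  qed
qed

end

theorem theorem2:
  fixes \<Gamma> :: "('a::metric_space \<Rightarrow> 'a) set"
  assumes proper: "\<forall>(x::'a) r. compact (cball x r)"
    and noncompact: "\<not> compact (UNIV :: 'a set)"
    and CAT: "CAT_minus_one TYPE('a)"
    and group: "subgroup \<Gamma> isometry_group"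
    and discrete: "properly_discontinuous \<Gamma>"
    and cocompact: "cocompact \<Gamma>"
  shows "(Omega :: ('a \<times> 'a \<Rightarrow> real) set set) \<subseteq> max_boundary \<and>
    (\<forall>g\<in>(geodesics :: (real \<Rightarrow> 'a) set). \<exists>!l. limitin max_compactification
        (\<lambda>n. max_embedding (g (real n), g (- real n))) l sequentially) \<and>
    homeomorphic_map (subtopology compact_convergence (geodesics :: (real \<Rightarrow> 'a) set))
      (subtopology max_compactification Omega) endpoint_map \<and>
    (\<forall>\<gamma>\<in>\<Gamma>. \<forall>g\<in>geodesics. endpoint_map (\<gamma> \<circ> g) = diag_action \<gamma> (endpoint_map g))"
proof -
  interpret proper_CAT_minus_one "TYPE('a)" using CAT proper by unfold_locales auto
  show ?thesis
  proof (intro conjI ballI)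
    show "\<exists>!l. limitin max_compactification (\<lambda>n. max_embedding (g (real n), g (- real n))) l sequentially"
      if "g \<in> (geodesics :: (real \<Rightarrow> 'a) set)" for g
      using that unfolding geodesics_iff
      by (intro ex1I) (fact limitin_max_embedding, fact limitin_max_embedding_unique)
    show "endpoint_map (\<gamma> \<circ> g) = diag_action \<gamma> (endpoint_map g)" if "\<gamma> \<in> \<Gamma>" "g \<in> geodesics" for \<gamma> g
      using that subgroup.subset[OF group] by (intro endpoint_map_equivariant) (auto simp: geodesics_iff)
  qed (rule Omega_subset_max_boundary, rule homeomorphic_map_endpoint_map)
qed

end
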